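(* Let $K$ be a field of positive characteristic, $S=K[x_1,\ldots,x_N]$, and let $I\subseteq S$ be a nonzero ideal. Then $$\tau(\lambda\bullet I)\subseteq\bigcap_{\substack{\mathfrak{p}\in\operatorname{Spec}(S)\\ \mathfrak{p}\supseteq I}}\mathfrak{p}^{(\lfloor\lambda e_{\mathfrak{p}}(I)\rfloor+1-\operatorname{ht}(\mathfrak{p}))}\qquad\text{for all }\lambda\in\mathbb{R}_{>0}.$$
   Context: For a prime $\mathfrak{p}$ of $S$, $\mathfrak{p}^{(\ell)}=\mathfrak{p}^\ell S_{\mathfrak{p}}\cap S$ is the $\ell$-th symbolic power for $\ell\ge1$, and $\mathfrak{p}^{(\ell)}=S$ for $\ell\le0$. $e_{\mathfrak{p}}(I)=\max\{\ell:I\subseteq\mathfrak{p}^{(\ell)}\}$. Test ideals: let $p=\operatorname{char}(K)$. For $q=p^e$ and an ideal $J$, $J^{[q]}=(f^q:f\in J)$, and $J^{[1/q]}$ is the smallest ideal $L\subseteq S$ with $J\subseteq L^{[q]}$. For $\lambda\in\mathbb{R}_{>0}$, $\tau(\lambda\bullet I)=\bigcup_{e>0}\big(I^{\lceil\lambda p^e\rceil}\big)^{[1/p^e]}$ (an increasing union). *)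

theory Defs
  imports
    "HOL-Library.Poly_Mapping"
    "HOL-Library.Extended_Nat"
    "HOL-Computational_Algebra.Fraction_Field"
    "HOL-Algebra.Ideal_Product"
    "HOL-Algebra.Algebraic_Closure_Type"
begin

text \<open>
  All rings below are subrings of an ambient type-class ring, represented as HOL-Algebra records by
  shrinking the carrier of \<open>ring_of_type_algebra\<close>.  Thus the polynomial rings in any number of
  variables over a field live in one type, and localizations of a domain live in its field of
  fractions.
\<close>

definition subring_of_type :: "'a::comm_ring_1 set \<Rightarrow> 'a ring" where
  "subring_of_type A = ring_of_type_algebra\<lparr>carrier := A\<rparr>"

text \<open>
  \<open>K[x\<^sub>1,\<dots>,x\<^sub>N]\<close>: a polynomial maps exponent vectors, finitely supported functions from variable
  indices to exponents, to coefficients; the variables are indexed by \<open>0,\<dots>,N-1\<close>.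
\<close>

definition mpoly_ring :: "nat \<Rightarrow> ((nat \<Rightarrow>\<^sub>0 nat) \<Rightarrow>\<^sub>0 'k::field) ring" where
  "mpoly_ring N = subring_of_type {f. \<forall>m \<in> Poly_Mapping.keys f. Poly_Mapping.keys m \<subseteq> {..<N}}"

definition ideal_power :: "('a, 'b) ring_scheme \<Rightarrow> 'a set \<Rightarrow> nat \<Rightarrow> 'a set" where
  "ideal_power R I n = I [^]\<^bsub>ideals_set R\<^esub> n"

definition localization :: "'a::idom ring \<Rightarrow> 'a set \<Rightarrow> 'a fract ring" where
  "localization R P = subring_of_type {Fract a s | a s. a \<in> carrier R \<and> s \<in> carrier R - P}"

text \<open>\<open>Fract f 1\<close> is the image of \<open>f\<close> in the localization.\<close>

definition symbolic_power :: "'a::idom ring \<Rightarrow> 'a set \<Rightarrow> int \<Rightarrow> 'a set" where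
  "symbolic_power R P l =
     (if l \<le> 0 then carrier R
      else {f \<in> carrier R.
        Fract f 1 \<in> Idl\<^bsub>localization R P\<^esub> ((\<lambda>g. Fract g 1) ` ideal_power R P (nat l))})"

text \<open>
  Only meaningful when \<open>I\<close> is contained in some but not all symbolic powers of \<open>P\<close>, as is the case
  for nonzero ideals \<open>I\<close> of a polynomial ring and prime \<open>P\<close>.
\<close>

definition vanishing_order :: "'a::idom ring \<Rightarrow> 'a set \<Rightarrow> 'a set \<Rightarrow> int" where
  "vanishing_order R P I = (GREATEST l. I \<subseteq> symbolic_power R P l)"

text \<open>The supremum of the lengths \<open>n\<close> of chains of primes \<open>Q\<^sub>0 \<subset> \<dots> \<subset> Q\<^sub>n = P\<close>.\<close>

definition height :: "('a, 'b) ring_scheme \<Rightarrow> 'a set \<Rightarrow> enat" where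
  "height R P = Sup {enat n | n.
     \<exists>Q :: nat \<Rightarrow> 'a set. (\<forall>i\<le>n. primeideal (Q i) R) \<and> (\<forall>i<n. Q i \<subset> Q (Suc i)) \<and> Q n = P}"

definition frobenius_power :: "('a, 'b) ring_scheme \<Rightarrow> nat \<Rightarrow> 'a set \<Rightarrow> 'a set" where
  "frobenius_power R q J = Idl\<^bsub>R\<^esub> ((\<lambda>f. f [^]\<^bsub>R\<^esub> q) ` J)"

text \<open>
  The least ideal (for inclusion) whose Frobenius power contains \<open>J\<close>; it exists in polynomial rings
  over a field of characteristic \<open>p > 0\<close> when \<open>q\<close> is a power of \<open>p\<close>.
\<close>

definition frobenius_root :: "('a, 'b) ring_scheme \<Rightarrow> nat \<Rightarrow> 'a set \<Rightarrow> 'a set" where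
  "frobenius_root R q J = (LEAST L. ideal L R \<and> J \<subseteq> frobenius_power R q L)"

definition test_ideal :: "('a, 'b) ring_scheme \<Rightarrow> nat \<Rightarrow> real \<Rightarrow> 'a set \<Rightarrow> 'a set" where
  "test_ideal R p t I =
     (\<Union>e\<in>{0<..}. frobenius_root R (p ^ e) (ideal_power R I (nat \<lceil>t * real (p ^ e)\<rceil>)))"

end

theory Submission
  imports Defs
begin

text \<open>
  Write \<open>q = p\<^sup>e\<close>. A basis of \<open>K\<close> over its \<open>q\<close>-th powers makes \<open>S\<close> free over its subring of
  \<open>q\<close>-th powers, and \<open>f\<close> lies in \<open>L\<^bsup>[q]\<^esup>\<close> iff all its coordinates (after taking \<open>q\<close>-th roots) lie
  in \<open>L\<close>. Hence \<open>J\<^bsup>[1/q]\<^esup>\<close> is generated by the coordinates of the elements of \<open>J\<close>, and \<open>L\<^bsup>[q]\<^esup>\<close> is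
  closed under cancelling \<open>s\<^sup>q\<close> whenever \<open>L\<close> is closed under cancelling \<open>s\<close>.

  The localization of \<open>S\<close> at a prime \<open>P\<close> has its maximal ideal generated by \<open>n \<le> ht P\<close> elements; this is
  proved by adjoining one variable at a time: over \<open>P \<inter> A\<close>, a prime \<open>P\<close> of \<open>A[x]\<close> needs at most one
  further generator, namely an element of minimal degree outside \<open>(P \<inter> A)[x]\<close>. By the pigeonhole
  principle \<open>P\<^bsup>(k)\<^esup> \<subseteq> (P\<^bsup>(j)\<^esup>)\<^bsup>[q]\<^esup>\<close> once \<open>k > q (j + n - 1) - n\<close>, so that
  \<open>I\<^sup>r \<subseteq> P\<^bsup>(m r)\<^esup> \<subseteq> (P\<^bsup>(j)\<^esup>)\<^bsup>[q]\<^esup>\<close> for \<open>m = e\<^sub>P(I)\<close>, \<open>r = \<lceil>t q\<rceil>\<close>, \<open>j = \<lfloor>t m\<rfloor> + 1 - ht P\<close>.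

  The case \<open>j = 1\<close> also bounds the vanishing order: if \<open>f\<close> lies in all \<open>P\<^bsup>(k)\<^esup>\<close>, it lies in
  all \<open>P\<^bsup>[q]\<^esup>\<close>; for \<open>q\<close> larger than the exponents in \<open>f\<close> its coordinates are constants, hence zero.
\<close>

section \<open>Ideals of subrings and saturation\<close>

lemma subring_of_type_simps [simp]:
  "carrier (subring_of_type A) = A"
  "x \<otimes>\<^bsub>subring_of_type A\<^esub> y = x * y"
  "x \<oplus>\<^bsub>subring_of_type A\<^esub> y = x + y"
  "\<zero>\<^bsub>subring_of_type A\<^esub> = 0"
  "\<one>\<^bsub>subring_of_type A\<^esub> = 1"
  by (simp_all add: subring_of_type_def ring_of_type_algebra_def)

lemma subring_of_type_pow [simp]: "x [^]\<^bsub>subring_of_type A\<^esub> (n::nat) = x ^ n"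
  by (induction n) (simp_all add: mult.commute)

text \<open>Subrings are handled as bare sets, so that closure is a matter of the type-class
  operations and the record \<open>ring_A\<close> enters only through ideals.\<close>

locale unital_subring =
  fixes A :: "'a::comm_ring_1 set"
  assumes one_mem [simp, intro]: "1 \<in> A"
    and add_mem [intro]: "x \<in> A \<Longrightarrow> y \<in> A \<Longrightarrow> x + y \<in> A"
    and mult_mem [intro]: "x \<in> A \<Longrightarrow> y \<in> A \<Longrightarrow> x * y \<in> A"
    and uminus_mem [intro]: "x \<in> A \<Longrightarrow> - x \<in> A"
begin

abbreviation ring_A :: "'a ring" where "ring_A \<equiv> subring_of_type A"

lemma zero_mem [simp, intro]: "0 \<in> A"
  using add_mem[OF one_mem uminus_mem[OF one_mem]] by simp

lemma minus_mem [intro]: "x \<in> A \<Longrightarrow> y \<in> A \<Longrightarrow> x - y \<in> A"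
  using add_mem[OF _ uminus_mem] by fastforce

lemma sum_mem: "(\<And>i. i \<in> Z \<Longrightarrow> f i \<in> A) \<Longrightarrow> sum f Z \<in> A"
  by (induction Z rule: infinite_finite_induct) auto

lemma prod_mem: "(\<And>i. i \<in> Z \<Longrightarrow> f i \<in> A) \<Longrightarrow> prod f Z \<in> A"
  by (induction Z rule: infinite_finite_induct) auto

lemma power_mem [intro]: "x \<in> A \<Longrightarrow> x ^ n \<in> A"
  by (induction n) auto

lemma cring_ring_A: "cring ring_A"
proof (intro cringI abelian_groupI comm_monoidI)
  fix x assume "x \<in> carrier ring_A"
  then show "\<exists>y\<in>carrier ring_A. y \<oplus>\<^bsub>ring_A\<^esub> x = \<zero>\<^bsub>ring_A\<^esub>"
    by (intro bexI[of _ "- x"]) auto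
qed (auto simp: algebra_simps)

lemma ring_ring_A: "ring ring_A"
  using cring_ring_A by (rule cring.axioms)

text \<open>Closure under negation comes from absorption, since \<open>- x = - 1 * x\<close> and
  \<open>- 1\<close> lies in \<open>A\<close>.\<close>

lemma ideal_iff:
  "ideal I ring_A \<longleftrightarrow> I \<subseteq> A \<and> 0 \<in> I \<and> (\<forall>x\<in>I. \<forall>y\<in>I. x + y \<in> I) \<and> (\<forall>a\<in>A. \<forall>x\<in>I. a * x \<in> I)"
  (is "_ \<longleftrightarrow> ?rhs")
proof
  assume "ideal I ring_A"
  then interpret ideal I ring_A .
  show ?rhs
    using additive_subgroup.a_subset[OF is_additive_subgroup]
      additive_subgroup.zero_closed[OF is_additive_subgroup]
      additive_subgroup.a_closed[OF is_additive_subgroup] I_l_closed by auto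
next
  assume I: ?rhs
  then have I': "\<forall>a\<in>A. \<forall>x\<in>I. x * a \<in> I" by (simp add: mult.commute)
  interpret ring ring_A by (rule ring_ring_A)
  show "ideal I ring_A"
  proof (rule idealI)
    show "subgroup I (add_monoid ring_A)"
    proof (rule add.subgroupI)
      fix x assume x: "x \<in> I"
      with I have "x \<in> A" by auto
      then have "\<ominus>\<^bsub>ring_A\<^esub> x = - 1 * x"
        by (intro minus_equality) auto
      with I x show "\<ominus>\<^bsub>ring_A\<^esub> x \<in> I"
        using uminus_mem[OF one_mem] by metis
    qed (use I in auto)
  qed (use I I' in \<open>auto simp: ring_axioms\<close>)
qed

lemma idealD:
  assumes "ideal I ring_A"
  shows "I \<subseteq> A" "0 \<in> I" "x \<in> I \<Longrightarrow> y \<in> I \<Longrightarrow> x + y \<in> I" "a \<in> A \<Longrightarrow> x \<in> I \<Longrightarrow> a * x \<in> I"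
    "a \<in> A \<Longrightarrow> x \<in> I \<Longrightarrow> x * a \<in> I"
  using assms by (auto simp: ideal_iff mult.commute)

lemma ideal_minus: "ideal I ring_A \<Longrightarrow> x \<in> I \<Longrightarrow> y \<in> I \<Longrightarrow> x - y \<in> I"
  using idealD(3)[of I x "- 1 * y"] idealD(4)[of I "- 1" y] uminus_mem[OF one_mem] by simp

lemma ideal_sum: "ideal I ring_A \<Longrightarrow> (\<And>i. i \<in> Z \<Longrightarrow> f i \<in> I) \<Longrightarrow> sum f Z \<in> I"
  by (induction Z rule: infinite_finite_induct) (auto intro: idealD)

lemma primeideal_iff:
  "primeideal P ring_A \<longleftrightarrow>
     ideal P ring_A \<and> 1 \<notin> P \<and> (\<forall>a\<in>A. \<forall>b\<in>A. a * b \<in> P \<longrightarrow> a \<in> P \<or> b \<in> P)"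
proof -
  have "A \<noteq> P \<longleftrightarrow> 1 \<notin> P" if "ideal P ring_A"
    using idealD(1)[OF that] idealD(4)[OF that, of _ 1] by auto
  then show ?thesis
    by (auto simp: primeideal_def primeideal_axioms_def cring_ring_A)
qed

lemma primeidealD:
  assumes "primeideal P ring_A"
  shows "ideal P ring_A" "1 \<notin> P" "a \<in> A \<Longrightarrow> b \<in> A \<Longrightarrow> a * b \<in> P \<Longrightarrow> a \<in> P \<or> b \<in> P"
    "0 \<in> P" "P \<subseteq> A"
  using assms idealD(1,2)[of P] by (auto simp: primeideal_iff)

lemma primeideal_mult_notin:
  "primeideal P ring_A \<Longrightarrow> s \<in> A - P \<Longrightarrow> t \<in> A - P \<Longrightarrow> s * t \<in> A - P"
  using primeidealD(3) by blast

lemma primeideal_power_notin: "primeideal P ring_A \<Longrightarrow> s \<in> A - P \<Longrightarrow> s ^ n \<in> A - P"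
  using primeidealD(2) primeideal_mult_notin by (induction n) auto

lemma genideal_ideal: "Z \<subseteq> A \<Longrightarrow> ideal (Idl\<^bsub>ring_A\<^esub> Z) ring_A"
  using ring.genideal_ideal[OF ring_ring_A] by simp

lemma genideal_self: "Z \<subseteq> A \<Longrightarrow> Z \<subseteq> Idl\<^bsub>ring_A\<^esub> Z"
  using ring.genideal_self[OF ring_ring_A] by simp

lemma genideal_minimal: "ideal J ring_A \<Longrightarrow> Z \<subseteq> J \<Longrightarrow> Idl\<^bsub>ring_A\<^esub> Z \<subseteq> J"
  using ring.genideal_minimal[OF ring_ring_A] by simp

lemma ideal_prod_subset:
  assumes "ideal T ring_A" "\<And>i j. i \<in> I \<Longrightarrow> j \<in> J \<Longrightarrow> i * j \<in> T"
  shows "ideal_prod ring_A I J \<subseteq> T"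
proof
  fix s assume "s \<in> ideal_prod ring_A I J"
  then show "s \<in> T"
    by (induction rule: ideal_prod.induct) (use assms in \<open>auto intro: idealD(3)\<close>)
qed

lemma ideal_power_0 [simp]: "ideal_power ring_A I 0 = A"
  by (simp add: ideal_power_def ideals_set_def)

lemma ideal_power_Suc: "ideal_power ring_A I (Suc n) = ideal_prod ring_A (ideal_power ring_A I n) I"
  by (simp add: ideal_power_def ideals_set_def)

lemma ideal_power_ideal: "ideal I ring_A \<Longrightarrow> ideal (ideal_power ring_A I n) ring_A"
  using ring.oneideal[OF ring_ring_A] ring.ideal_prod_is_ideal[OF ring_ring_A]
  by (induction n) (auto simp: ideal_power_Suc)

lemma mult_mem_ideal_power_Suc:
  "x \<in> ideal_power ring_A I n \<Longrightarrow> y \<in> I \<Longrightarrow> x * y \<in> ideal_power ring_A I (Suc n)"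
  using ideal_prod.prod[of x "ideal_power ring_A I n" y I ring_A] by (simp add: ideal_power_Suc)

lemma ideal_power_antimono:
  assumes "ideal I ring_A" "m \<le> n"
  shows "ideal_power ring_A I n \<subseteq> ideal_power ring_A I m"
  using assms(2,1)
proof (induction rule: inc_induct)
  case (step k)
  then show ?case
    using ring.ideal_prod_inter[OF ring_ring_A ideal_power_ideal[of I k]]
    by (auto simp: ideal_power_Suc)
qed auto

text \<open>Fixing one factor turns a claim about products into membership in an ideal, so that it
  has to be checked on generators only.\<close>

lemma ideal_colon: "ideal T ring_A \<Longrightarrow> ideal {u \<in> A. u * v \<in> T} ring_A"
  by (auto simp: ideal_iff distrib_right mult.assoc)

lemma mult_mem_ideal_power_add:
  assumes I: "ideal I ring_A" and x: "x \<in> ideal_power ring_A I m"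
    and y: "y \<in> ideal_power ring_A I n"
  shows "x * y \<in> ideal_power ring_A I (m + n)"
  using y
proof (induction n arbitrary: y)
  case 0
  then show ?case using x idealD(5)[OF ideal_power_ideal[OF I]] by auto
next
  case (Suc n)
  let ?T = "{u \<in> A. u * x \<in> ideal_power ring_A I (m + Suc n)}"
  have "ideal_prod ring_A (ideal_power ring_A I n) I \<subseteq> ?T"
  proof (rule ideal_prod_subset)
    fix i j assume ij: "i \<in> ideal_power ring_A I n" "j \<in> I"
    then have "x * i * j \<in> ideal_power ring_A I (Suc (m + n))"
      by (intro mult_mem_ideal_power_Suc Suc.IH)
    then show "i * j \<in> ?T"
      using ij idealD(1)[OF I] idealD(1)[OF ideal_power_ideal[OF I]] by (auto simp: mult_ac)
  qed (intro ideal_colon ideal_power_ideal I)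
  then show ?case using Suc.prems by (auto simp: ideal_power_Suc mult.commute)
qed

lemma prod_powers_mem_ideal_power:
  assumes "ideal I ring_A" "finite Z" "\<And>i. i \<in> Z \<Longrightarrow> f i \<in> I"
  shows "(\<Prod>i\<in>Z. f i ^ a i) \<in> ideal_power ring_A I (sum a Z)"
  using assms(2,3)
proof (induction Z)
  case (insert x Z)
  have "f x ^ n \<in> ideal_power ring_A I n" for n
    using insert.prems mult_mem_ideal_power_Suc[of "f x ^ n" I n "f x" for n]
    by (induction n) (auto simp: mult.commute)
  then show ?case
    using insert by (auto intro: mult_mem_ideal_power_add[OF assms(1)])
qed auto

end

text \<open>The saturation is the contraction of the extension of \<open>J\<close> to the localization of \<open>A\<close> at
  \<open>P\<close>.\<close>

definition saturation :: "'a::comm_ring_1 set \<Rightarrow> 'a set \<Rightarrow> 'a set \<Rightarrow> 'a set" where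
  "saturation A P J = {f \<in> A. \<exists>s \<in> A - P. s * f \<in> J}"

lemma (in unital_subring) saturation_ideal:
  assumes P: "primeideal P ring_A" and J: "ideal J ring_A"
  shows "ideal (saturation A P J) ring_A"
  unfolding ideal_iff
proof (intro conjI ballI)
  show "saturation A P J \<subseteq> A" by (auto simp: saturation_def)
  show "0 \<in> saturation A P J"
    using primeidealD(2)[OF P] idealD(2)[OF J] by (auto simp: saturation_def)
next
  fix x y assume "x \<in> saturation A P J" "y \<in> saturation A P J"
  then obtain s t where st: "s \<in> A - P" "t \<in> A - P" "s * x \<in> J" "t * y \<in> J" "x \<in> A" "y \<in> A"
    by (auto simp: saturation_def)
  then have "t * (s * x) + s * (t * y) \<in> J"
    by (auto intro!: idealD(3,4)[OF J])
  then have "s * t * (x + y) \<in> J" by (simp add: algebra_simps)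
  then show "x + y \<in> saturation A P J"
    using primeideal_mult_notin[OF P st(1,2)] st by (auto simp: saturation_def)
next
  fix a x assume "a \<in> A" "x \<in> saturation A P J"
  then obtain s where s: "s \<in> A - P" "a * (s * x) \<in> J" "x \<in> A"
    using idealD(4)[OF J] by (auto simp: saturation_def)
  then show "a * x \<in> saturation A P J"
    using \<open>a \<in> A\<close> by (auto simp: saturation_def intro!: bexI[of _ s]) (simp add: mult_ac)
qed

lemma (in unital_subring) saturation_mono: "J \<subseteq> J' \<Longrightarrow> saturation A P J \<subseteq> saturation A P J'"
  by (auto simp: saturation_def)

lemma (in unital_subring) subset_saturation:
  assumes "primeideal P ring_A" "J \<subseteq> A"
  shows "J \<subseteq> saturation A P J"
proof
  fix x assume "x \<in> J"
  then have "1 \<in> A - P" "1 * x \<in> J" using assms primeidealD by auto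
  then show "x \<in> saturation A P J" using assms \<open>x \<in> J\<close> unfolding saturation_def by blast
qed

text \<open>Multipliers outside \<open>P\<close> compose because \<open>P\<close> is prime. This
  cancellation property is what later passes from an ideal to its Frobenius powers.\<close>

lemma (in unital_subring) saturation_saturated:
  assumes "primeideal P ring_A" "s \<in> A - P" "f \<in> A" "s * f \<in> saturation A P J"
  shows "f \<in> saturation A P J"
proof -
  obtain u where "u \<in> A - P" "u * (s * f) \<in> J" using assms by (auto simp: saturation_def)
  then show ?thesis
    using assms primeideal_mult_notin[OF assms(1), of u s]
    by (auto simp: saturation_def mult.assoc intro!: bexI[of _ "u * s"])
qed

lemma (in unital_subring) mult_mem_saturation:
  assumes "primeideal P ring_A" "x \<in> saturation A P J" "y \<in> saturation A P J'"
    and "\<And>u v. u \<in> J \<Longrightarrow> v \<in> J' \<Longrightarrow> u * v \<in> T"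
  shows "x * y \<in> saturation A P T"
proof -
  obtain s t where st: "s \<in> A - P" "t \<in> A - P" "s * x \<in> J" "t * y \<in> J'" "x \<in> A" "y \<in> A"
    using assms by (auto simp: saturation_def)
  then have "s * t * (x * y) \<in> T" using assms(4)[of "s * x" "t * y"] by (simp add: mult_ac)
  then show ?thesis
    using st primeideal_mult_notin[OF assms(1), of s t]
    by (auto simp: saturation_def intro!: bexI[of _ "s * t"])
qed

text \<open>The family \<open>J\<close> plays the role of the powers of \<open>T\<close>. It is
  applied to the ideals of monomials of degree \<open>k\<close> in local generators of
  \<open>P\<close>, and to \<open>J k = P^(m k)\<close> with \<open>T = P^m\<close>.\<close>

lemma (in unital_subring) ideal_power_saturation:
  assumes "primeideal P ring_A" "\<And>k. ideal (J k) ring_A" "J 0 = A"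
    and "I \<subseteq> saturation A P T"
    and "\<And>k u v. u \<in> J k \<Longrightarrow> v \<in> T \<Longrightarrow> u * v \<in> J (Suc k)"
  shows "ideal_power ring_A I k \<subseteq> saturation A P (J k)"
proof (induction k)
  case 0
  then show ?case using subset_saturation[OF assms(1)] assms(3) by simp
next
  case (Suc k)
  show ?case
    unfolding ideal_power_Suc
  proof (rule ideal_prod_subset)
    fix i j assume "i \<in> ideal_power ring_A I k" "j \<in> I"
    then show "i * j \<in> saturation A P (J (Suc k))"
      using Suc assms(4) mult_mem_saturation[OF assms(1) _ _ assms(5)] by blast
  qed (intro saturation_ideal assms)
qed

text \<open>Clearing denominators removes the field of fractions: all later arguments multiply by
  elements outside \<open>P\<close> instead of working in the localization.\<close>

lemma symbolic_power_eq_saturation: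
  fixes A :: "'a::idom set"
  assumes A: "unital_subring A" and P: "primeideal P (subring_of_type A)" and l: "l > 0"
  shows "symbolic_power (subring_of_type A) P l =
    saturation A P (ideal_power (subring_of_type A) P (nat l))"
proof -
  interpret unital_subring A by fact
  define J where "J = ideal_power ring_A P (nat l)"
  define L where "L = {Fract a s | a s. a \<in> A \<and> s \<in> A - P}"
  have J: "ideal J ring_A"
    unfolding J_def by (intro ideal_power_ideal primeidealD(1) P)
  have nz: "s \<noteq> 0" if "s \<in> A - P" for s
    using that primeidealD(4)[OF P] by auto
  have one: "1 \<in> A - P" using primeidealD(2)[OF P] by auto
  have mult: "s * t \<in> A - P" if "s \<in> A - P" "t \<in> A - P" for s t
    using that by (rule primeideal_mult_notin[OF P])
  interpret L: unital_subring L
  proof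
    show "1 \<in> L" unfolding L_def using one by (auto simp: One_fract_def)
  next
    fix x y assume "x \<in> L" "y \<in> L"
    then obtain a s b t where xy: "x = Fract a s" "y = Fract b t" "a \<in> A" "b \<in> A"
      "s \<in> A - P" "t \<in> A - P"
      unfolding L_def by blast
    then have "x + y = Fract (a * t + b * s) (s * t)" "x * y = Fract (a * b) (s * t)"
      using nz by auto
    then show "x + y \<in> L" "x * y \<in> L"
      unfolding L_def using xy mult[of s t] by blast+
  next
    fix x assume "x \<in> L"
    then show "- x \<in> L" unfolding L_def using minus_fract by blast
  qed
  have loc: "localization ring_A P = L.ring_A"
    by (simp add: localization_def L_def)
  \<comment> \<open>This is the extension of \<open>J\<close> to the localization. Being an ideal
    that contains the image of \<open>J\<close>, it contains the generated ideal, so each element of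
    the latter has a numerator in \<open>J\<close>.\<close>
  define E where "E = {Fract a s | a s. a \<in> J \<and> s \<in> A - P}"
  have E: "ideal E L.ring_A"
    unfolding L.ideal_iff
  proof (intro conjI ballI)
    show "E \<subseteq> L" using idealD(1)[OF J] by (auto simp: E_def L_def)
    show "0 \<in> E" unfolding E_def using one idealD(2)[OF J] by (auto simp: Zero_fract_def)
  next
    fix x y assume "x \<in> E" "y \<in> E"
    then obtain a s b t where xy: "x = Fract a s" "y = Fract b t" "a \<in> J" "b \<in> J"
      "s \<in> A - P" "t \<in> A - P"
      unfolding E_def by blast
    then have "x + y = Fract (a * t + b * s) (s * t)" "a * t + b * s \<in> J"
      using nz by (auto intro: idealD(3,5)[OF J])
    then show "x + y \<in> E" unfolding E_def using mult[of s t] xy by blast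
  next
    fix x y assume "x \<in> L" "y \<in> E"
    then obtain a s b t where xy: "x = Fract a s" "y = Fract b t" "a \<in> A" "b \<in> J"
      "s \<in> A - P" "t \<in> A - P"
      unfolding E_def L_def by blast
    then have "x * y = Fract (a * b) (s * t)" "a * b \<in> J"
      by (auto intro: idealD(4)[OF J])
    then show "x * y \<in> E" unfolding E_def using mult[of s t] xy by blast
  qed
  have EJ: "(\<lambda>g. Fract g 1) ` J \<subseteq> E" unfolding E_def using one by blast
  have "Fract f 1 \<in> Idl\<^bsub>L.ring_A\<^esub> ((\<lambda>g. Fract g 1) ` J) \<longleftrightarrow> (\<exists>s\<in>A - P. s * f \<in> J)"
    if f: "f \<in> A" for f
  proof
    assume "Fract f 1 \<in> Idl\<^bsub>L.ring_A\<^esub> ((\<lambda>g. Fract g 1) ` J)"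
    then have "Fract f 1 \<in> E" using L.genideal_minimal[OF E EJ] by blast
    then obtain a s where "Fract f 1 = Fract a s" "a \<in> J" "s \<in> A - P" unfolding E_def by blast
    then show "\<exists>s\<in>A - P. s * f \<in> J" using nz by (auto simp: eq_fract mult.commute)
  next
    assume "\<exists>s\<in>A - P. s * f \<in> J"
    then obtain s where s: "s \<in> A - P" "s * f \<in> J" by blast
    have sub: "(\<lambda>g. Fract g 1) ` J \<subseteq> L"
      using EJ L.idealD(1)[OF E] by blast
    have "Fract 1 s \<in> L" using s by (auto simp: L_def)
    moreover have "Fract (s * f) 1 \<in> Idl\<^bsub>L.ring_A\<^esub> ((\<lambda>g. Fract g 1) ` J)"
      using s L.genideal_self[OF sub] by blast
    ultimately have "Fract 1 s * Fract (s * f) 1 \<in> Idl\<^bsub>L.ring_A\<^esub> ((\<lambda>g. Fract g 1) ` J)"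
      by (intro L.idealD(4)[OF L.genideal_ideal[OF sub]])
    moreover have "Fract 1 s * Fract (s * f) 1 = Fract f 1"
      using nz[OF s(1)] by (simp add: eq_fract)
    ultimately show "Fract f 1 \<in> Idl\<^bsub>L.ring_A\<^esub> ((\<lambda>g. Fract g 1) ` J)" by simp
  qed
  with l show ?thesis
    by (auto simp: symbolic_power_def saturation_def loc J_def)
qed

section \<open>Primes in a polynomial extension\<close>

definition polys :: "'a::comm_ring_1 set \<Rightarrow> 'a poly set" where
  "polys C = {p. \<forall>i. coeff p i \<in> C}"

text \<open>The variable \<open>x\<close> is an element of the ambient domain, transcendental over
  \<open>A\<close>. Thus \<open>A[x]\<close> stays in the type of \<open>A\<close> and the
  construction can be iterated; the type \<open>'a poly\<close> serves only to represent elements of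
  \<open>A[x]\<close>.\<close>

locale polynomial_extension = unital_subring A for A :: "'a::idom set" +
  fixes x :: 'a
  assumes transcendental: "p \<in> polys A \<Longrightarrow> poly p x = 0 \<Longrightarrow> p = 0"
begin

text \<open>For \<open>C = A\<close> this is the ring \<open>A[x]\<close>, and for an ideal
  \<open>C\<close> of \<open>A\<close> it is the extended ideal \<open>C[x]\<close>.\<close>

definition ext :: "'a set \<Rightarrow> 'a set" where
  "ext C = (\<lambda>p. poly p x) ` polys C"

lemma polys_mono: "C \<subseteq> D \<Longrightarrow> polys C \<subseteq> polys D"
  by (auto simp: polys_def)

lemma polys_ideal_add: "ideal I ring_A \<Longrightarrow> p \<in> polys I \<Longrightarrow> q \<in> polys I \<Longrightarrow> p + q \<in> polys I"
  by (auto simp: polys_def intro: idealD(3))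

lemma polys_ideal_mult: "ideal I ring_A \<Longrightarrow> p \<in> polys A \<Longrightarrow> q \<in> polys I \<Longrightarrow> p * q \<in> polys I"
  by (auto simp: polys_def coeff_mult intro!: ideal_sum idealD(4))

lemma ideal_A: "ideal A ring_A"
  by (auto simp: ideal_iff)

lemma polys_add: "p \<in> polys A \<Longrightarrow> q \<in> polys A \<Longrightarrow> p + q \<in> polys A"
  by (rule polys_ideal_add[OF ideal_A])

lemma polys_mult: "p \<in> polys A \<Longrightarrow> q \<in> polys A \<Longrightarrow> p * q \<in> polys A"
  by (rule polys_ideal_mult[OF ideal_A])

lemma polys_uminus: "p \<in> polys A \<Longrightarrow> - p \<in> polys A"
  by (auto simp: polys_def)

lemma polys_minus: "p \<in> polys A \<Longrightarrow> q \<in> polys A \<Longrightarrow> p - q \<in> polys A"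
  by (auto simp: polys_def)

lemma polys_smult: "c \<in> A \<Longrightarrow> p \<in> polys A \<Longrightarrow> smult c p \<in> polys A"
  by (auto simp: polys_def)

lemma polys_monom: "0 \<in> C \<Longrightarrow> c \<in> C \<Longrightarrow> monom c n \<in> polys C"
  by (auto simp: polys_def)

lemma polys_const: "0 \<in> C \<Longrightarrow> c \<in> C \<Longrightarrow> [:c:] \<in> polys C"
  by (auto simp: polys_def coeff_pCons split: nat.splits)

lemma poly_inj: "p \<in> polys A \<Longrightarrow> q \<in> polys A \<Longrightarrow> poly p x = poly q x \<Longrightarrow> p = q"
  using transcendental[of "p - q"] polys_minus by auto

lemma poly_mem_ext_iff:
  assumes "I \<subseteq> A" "p \<in> polys A"
  shows "poly p x \<in> ext I \<longleftrightarrow> p \<in> polys I"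
proof
  assume "poly p x \<in> ext I"
  then obtain q where "q \<in> polys I" "poly p x = poly q x" by (auto simp: ext_def)
  then show "p \<in> polys I" using poly_inj[of p q] polys_mono[of I A] assms by auto
qed (auto simp: ext_def)

lemma ext_mono: "C \<subseteq> D \<Longrightarrow> ext C \<subseteq> ext D"
  unfolding ext_def by (intro image_mono polys_mono)

lemma subset_ext: "0 \<in> C \<Longrightarrow> C \<subseteq> ext C"
  using polys_const by (force simp: ext_def)

lemma mem_extE:
  assumes "g \<in> ext C"
  obtains p where "p \<in> polys C" "g = poly p x"
  using assms by (auto simp: ext_def)

lemma ext_A_subring: "unital_subring (ext A)"
proof
  show "1 \<in> ext A" using subset_ext by auto
next
  fix u v assume "u \<in> ext A" "v \<in> ext A"
  then obtain p q where pq: "p \<in> polys A" "q \<in> polys A" "u = poly p x" "v = poly q x"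
    by (auto elim!: mem_extE)
  show "u + v \<in> ext A" unfolding ext_def
    by (rule image_eqI[of _ _ "p + q"]) (use pq polys_add in auto)
  show "u * v \<in> ext A" unfolding ext_def
    by (rule image_eqI[of _ _ "p * q"]) (use pq polys_mult in auto)
next
  fix u assume "u \<in> ext A"
  then obtain p where p: "p \<in> polys A" "u = poly p x" by (auto elim!: mem_extE)
  show "- u \<in> ext A" unfolding ext_def
    by (rule image_eqI[of _ _ "- p"]) (use p polys_uminus in auto)
qed

sublocale B: unital_subring "ext A" by (rule ext_A_subring)

lemma A_subset_ext: "A \<subseteq> ext A"
  by (rule subset_ext) simp

lemma power_x_mem: "x ^ i \<in> ext A"
  unfolding ext_def by (rule image_eqI[of _ _ "monom 1 i"]) (auto simp: poly_monom intro: polys_monom)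

lemma ext_subset_ideal: "ideal J B.ring_A \<Longrightarrow> C \<subseteq> J \<Longrightarrow> ext C \<subseteq> J"
  by (auto simp: ext_def poly_altdef polys_def intro!: B.ideal_sum B.idealD(5) power_x_mem)

lemma ext_ideal:
  assumes "ideal I ring_A"
  shows "ideal (ext I) B.ring_A"
  unfolding B.ideal_iff
proof (intro conjI ballI)
  show "ext I \<subseteq> ext A" using idealD(1)[OF assms] by (rule ext_mono)
  show "0 \<in> ext I" using subset_ext idealD(2)[OF assms] by auto
next
  fix u v assume "u \<in> ext I" "v \<in> ext I"
  then obtain p q where pq: "p \<in> polys I" "q \<in> polys I" "u = poly p x" "v = poly q x"
    by (auto elim!: mem_extE)
  show "u + v \<in> ext I" unfolding ext_def
    by (rule image_eqI[of _ _ "p + q"]) (use pq polys_ideal_add[OF assms] in auto)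
next
  fix u v assume "u \<in> ext A" "v \<in> ext I"
  then obtain p q where pq: "p \<in> polys A" "q \<in> polys I" "u = poly p x" "v = poly q x"
    by (auto elim!: mem_extE)
  show "u * v \<in> ext I" unfolding ext_def
    by (rule image_eqI[of _ _ "p * q"]) (use pq polys_ideal_mult[OF assms] in auto)
qed

text \<open>Gauss's argument: let \<open>i\<close> and \<open>j\<close> be the lowest indices of
  coefficients of \<open>p\<close> and \<open>q\<close> outside \<open>Q\<close>. In the coefficient
  of \<open>p * q\<close> at \<open>i + j\<close>, every term other than
  \<open>coeff p i * coeff q j\<close> lies in \<open>Q\<close>.\<close>

lemma polys_prime:
  assumes Q: "primeideal Q ring_A" and p: "p \<in> polys A" and q: "q \<in> polys A"
    and pq: "p * q \<in> polys Q"
  shows "p \<in> polys Q \<or> q \<in> polys Q"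
proof (rule ccontr)
  assume "\<not> ?thesis"
  then have "\<exists>i. coeff p i \<notin> Q" "\<exists>j. coeff q j \<notin> Q" by (auto simp: polys_def)
  then obtain i j where i: "coeff p i \<notin> Q" "\<And>k. k < i \<Longrightarrow> coeff p k \<in> Q"
    and j: "coeff q j \<notin> Q" "\<And>k. k < j \<Longrightarrow> coeff q k \<in> Q"
    using exists_least_iff[of "\<lambda>i. coeff p i \<notin> Q"] exists_least_iff[of "\<lambda>i. coeff q i \<notin> Q"]
    by blast
  have pA: "coeff p k \<in> A" and qA: "coeff q k \<in> A" for k
    using p q by (auto simp: polys_def)
  note Qi = primeidealD(1)[OF Q]
  have "coeff p k * coeff q (i + j - k) \<in> Q" if "k \<in> {..i + j} - {i}" for k
  proof (cases "k < i")
    case True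
    then show ?thesis using i pA qA by (auto intro: idealD(5)[OF Qi])
  next
    case False
    then show ?thesis using that j pA qA by (auto intro: idealD(4)[OF Qi])
  qed
  then have rest: "(\<Sum>k\<in>{..i + j} - {i}. coeff p k * coeff q (i + j - k)) \<in> Q"
    by (intro ideal_sum[OF Qi])
  have "coeff (p * q) (i + j) \<in> Q" using pq by (auto simp: polys_def)
  moreover have "coeff (p * q) (i + j) =
      coeff p i * coeff q j + (\<Sum>k\<in>{..i + j} - {i}. coeff p k * coeff q (i + j - k))"
    unfolding coeff_mult by (subst sum.remove[of _ i]) auto
  ultimately have "coeff p i * coeff q j \<in> Q"
    using ideal_minus[OF Qi _ rest] by fastforce
  then show False using primeidealD(3)[OF Q] i j pA qA by blast
qed

lemma ext_primeideal:
  assumes Q: "primeideal Q ring_A"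
  shows "primeideal (ext Q) B.ring_A"
  unfolding B.primeideal_iff
proof (intro conjI ballI impI)
  note QA = primeidealD(5)[OF Q]
  show "ideal (ext Q) B.ring_A" by (intro ext_ideal primeidealD(1) Q)
  show "1 \<notin> ext Q"
    using poly_mem_ext_iff[OF QA, of "[:1:]"] polys_const[of A 1] primeidealD(2)[OF Q]
    by (auto simp: polys_def dest: spec[of _ 0])
  fix u v assume uv: "u \<in> ext A" "v \<in> ext A" "u * v \<in> ext Q"
  then obtain p q where pq: "p \<in> polys A" "q \<in> polys A" "u = poly p x" "v = poly q x"
    by (auto elim!: mem_extE)
  with uv show "u \<in> ext Q \<or> v \<in> ext Q"
    using polys_prime[OF Q, of p q] poly_mem_ext_iff[OF QA] polys_mult[of p q]
    by (metis poly_mult)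
qed

lemma ext_Int_A:
  assumes "ideal I ring_A"
  shows "ext I \<inter> A = I"
proof
  show "ext I \<inter> A \<subseteq> I"
  proof
    fix a assume "a \<in> ext I \<inter> A"
    then have "[:a:] \<in> polys I"
      using poly_mem_ext_iff[of I "[:a:]"] idealD(1)[OF assms] polys_const[of A a] by auto
    then show "a \<in> I" by (auto simp: polys_def dest: spec[of _ 0])
  qed
  show "I \<subseteq> ext I \<inter> A" using subset_ext idealD(1,2)[OF assms] by auto
qed

lemma contraction_primeideal:
  assumes P: "primeideal P B.ring_A"
  shows "primeideal (P \<inter> A) ring_A"
  unfolding primeideal_iff ideal_iff
  using B.primeidealD[OF P] B.idealD[of P] A_subset_ext by (auto simp: subset_iff)

lemma ext_contraction_subset: "primeideal P B.ring_A \<Longrightarrow> ext (P \<inter> A) \<subseteq> P"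
  by (intro ext_subset_ideal B.primeidealD(1)) auto

lemma ext_strict_mono:
  assumes "ideal I ring_A" "ideal J ring_A" "I \<subset> J"
  shows "ext I \<subset> ext J"
proof (rule psubsetI)
  show "ext I \<subseteq> ext J" using assms(3) by (intro ext_mono) auto
  show "ext I \<noteq> ext J"
  proof
    assume "ext I = ext J"
    then have "ext I \<inter> A = ext J \<inter> A" by (rule arg_cong)
    then have "I = J" unfolding ext_Int_A[OF assms(1)] ext_Int_A[OF assms(2)] .
    then show False using assms(3) by blast
  qed
qed

text \<open>The leading coefficient of \<open>f\<close> may fail to be a unit of \<open>A\<close>,
  so \<open>g\<close> is multiplied by it once per division step, which keeps all coefficients in
  \<open>A\<close>.\<close>

lemma pseudo_division:
  assumes f: "f \<in> polys A" "degree f > 0" and g: "g \<in> polys A"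
  shows "\<exists>k h r. h \<in> polys A \<and> r \<in> polys A \<and> smult (lead_coeff f ^ k) g = f * h + r \<and>
    degree r < degree f"
  using g
proof (induction "degree g" arbitrary: g rule: less_induct)
  case less
  let ?c = "lead_coeff f"
  have c: "?c \<in> A" using f by (auto simp: polys_def)
  show ?case
  proof (cases "degree g < degree f")
    case True
    have "0 \<in> polys A" by (simp add: polys_def)
    with True less.prems show ?thesis
      by (intro exI[of _ 0] exI[of _ g]) auto
  next
    case False
    define m where "m = monom (lead_coeff g) (degree g - degree f)"
    define g' where "g' = smult ?c g - m * f"
    have m: "m \<in> polys A"
      using less.prems unfolding m_def by (intro polys_monom) (auto simp: polys_def)
    have g': "g' \<in> polys A"
      unfolding g'_def using less.prems f m c by (intro polys_minus polys_smult polys_mult)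
    have "coeff g' i = 0" if "i \<ge> degree g" for i
    proof (cases "i = degree g")
      case True
      then show ?thesis using False by (simp add: g'_def m_def coeff_monom_mult)
    next
      case neq: False
      then have "degree g < i" using that by simp
      moreover from this have "degree f < i - (degree g - degree f)" using False by simp
      ultimately show ?thesis by (simp add: g'_def m_def coeff_monom_mult coeff_eq_0)
    qed
    \<comment> \<open>The degree of \<open>g\<close> is positive because it is at least that of
      \<open>f\<close>, so the strict inequality also holds when \<open>g' = 0\<close>.\<close>
    then have "degree g' < degree g"
      using False f by (intro degree_lessI) auto
    from less.hyps[OF this g'] obtain k h r
      where khr: "h \<in> polys A" "r \<in> polys A" "smult (?c ^ k) g' = f * h + r" "degree r < degree f"
      by blast
    have "smult (?c ^ k) g' = smult (?c ^ Suc k) g - f * smult (?c ^ k) m"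
      by (simp add: g'_def smult_diff_right mult_ac)
    with khr(3) have "smult (?c ^ Suc k) g = f * (h + smult (?c ^ k) m) + r"
      by (simp add: algebra_simps)
    moreover have "h + smult (?c ^ k) m \<in> polys A"
      using khr m c by (intro polys_add polys_smult power_mem)
    ultimately show ?thesis using khr by blast
  qed
qed

text \<open>Take \<open>f\<close> of least degree representing an element of \<open>P\<close>
  outside \<open>(P \<inter> A)[x]\<close>. If its leading coefficient were in \<open>P\<close>,
  removing the leading term would give such a polynomial of smaller degree. A leading coefficient
  outside \<open>P\<close> becomes a unit at \<open>P\<close>, which makes pseudo-division by
  \<open>f\<close> effective there.\<close>

lemma obtain_minimal_degree:
  assumes P: "primeideal P B.ring_A" and "\<not> P \<subseteq> ext (P \<inter> A)"
  obtains f where "f \<in> polys A" "poly f x \<in> P" "f \<notin> polys (P \<inter> A)" "degree f > 0"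
    "lead_coeff f \<in> A - P"
    "\<And>g. g \<in> polys A \<Longrightarrow> poly g x \<in> P \<Longrightarrow> degree g < degree f \<Longrightarrow> g \<in> polys (P \<inter> A)"
proof -
  let ?Q = "P \<inter> A"
  note PI = B.primeidealD(1)[OF P]
  have Q: "ideal ?Q ring_A" using contraction_primeideal[OF P] primeidealD(1) by blast
  let ?D = "\<lambda>f. f \<in> polys A \<and> poly f x \<in> P \<and> f \<notin> polys ?Q"
  obtain g where "g \<in> P" "g \<notin> ext ?Q" using assms by blast
  then have "\<exists>f. ?D f"
    using B.primeidealD(5)[OF P] by (fastforce simp: ext_def)
  then obtain f where f: "?D f" "\<And>g. ?D g \<Longrightarrow> degree f \<le> degree g"
    using ex_has_least_nat[of ?D] by blast
  have min: "g \<in> polys ?Q" if "g \<in> polys A" "poly g x \<in> P" "degree g < degree f" for g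
    using f(2)[of g] that by auto
  have pos: "degree f > 0"
  proof (rule ccontr)
    assume "\<not> degree f > 0"
    then obtain a where "f = [:a:]" by (auto elim: degree_eq_zeroE)
    with f(1) polys_const[of ?Q a] idealD(2)[OF Q] show False
      by (auto simp: polys_def dest: spec[of _ 0])
  qed
  have "lead_coeff f \<notin> P"
  proof
    assume lc: "lead_coeff f \<in> P"
    let ?m = "monom (lead_coeff f) (degree f)"
    have lcQ: "lead_coeff f \<in> ?Q" using lc f(1) by (auto simp: polys_def)
    have "poly ?m x \<in> P"
      using lc power_x_mem by (auto simp: poly_monom intro: B.idealD(5)[OF PI])
    then have "poly (f - ?m) x \<in> P"
      using f(1) by (auto intro: B.ideal_minus[OF PI])
    moreover have m: "?m \<in> polys ?Q"
      using lcQ idealD(2)[OF Q] by (intro polys_monom) auto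
    moreover from this have "f - ?m \<in> polys A"
      using f(1) polys_mono[of ?Q A] by (intro polys_minus) auto
    moreover have "degree (f - ?m) < degree f"
      using pos by (intro degree_lessI) (auto simp: coeff_eq_0)
    ultimately have "f - ?m \<in> polys ?Q" by (intro min)
    then have "f - ?m + ?m \<in> polys ?Q" using m by (rule polys_ideal_add[OF Q])
    then show False using f(1) by simp
  qed
  moreover have "lead_coeff f \<in> A" using f(1) by (auto simp: polys_def)
  ultimately show ?thesis using that[of f] f(1) pos min by blast
qed

end

definition prime_chain :: "('a, 'b) ring_scheme \<Rightarrow> (nat \<Rightarrow> 'a set) \<Rightarrow> nat \<Rightarrow> bool" where
  "prime_chain R Q n \<longleftrightarrow> (\<forall>i\<le>n. primeideal (Q i) R) \<and> (\<forall>i<n. Q i \<subset> Q (Suc i))"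

text \<open>The localization of \<open>A\<close> at every prime \<open>P\<close> has its maximal ideal generated by \<open>n\<close> elements,
  where \<open>n\<close> is the length of some chain of primes ending in \<open>P\<close>.\<close>

definition locally_regular :: "'a::comm_ring_1 set \<Rightarrow> bool" where
  "locally_regular A \<longleftrightarrow> (\<forall>P. primeideal P (subring_of_type A) \<longrightarrow>
     (\<exists>n Q f. prime_chain (subring_of_type A) Q n \<and> Q n = P \<and> f ` {..<n} \<subseteq> P \<and>
       P \<subseteq> saturation A P (Idl\<^bsub>subring_of_type A\<^esub> (f ` {..<n::nat}))))"

context polynomial_extension
begin

text \<open>Multipliers in \<open>A\<close> outside \<open>P \<inter> A\<close> are also outside
  \<open>P\<close>, so local generators of the contraction still generate its extension locally at
  \<open>P\<close>.\<close>

lemma ext_contraction_subset_saturation: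
  assumes P: "primeideal P B.ring_A" and J: "ideal J B.ring_A"
    and G: "G \<subseteq> A" "G \<subseteq> J" "P \<inter> A \<subseteq> saturation A (P \<inter> A) (Idl\<^bsub>ring_A\<^esub> G)"
  shows "ext (P \<inter> A) \<subseteq> saturation (ext A) P J"
proof (rule ext_subset_ideal)
  show "ideal (saturation (ext A) P J) B.ring_A" by (rule B.saturation_ideal[OF P J])
  have "ideal (J \<inter> A) ring_A"
    unfolding ideal_iff using B.idealD[OF J] A_subset_ext by auto
  then have "Idl\<^bsub>ring_A\<^esub> G \<subseteq> J"
    using genideal_minimal[of "J \<inter> A" G] G by auto
  with G show "P \<inter> A \<subseteq> saturation (ext A) P J"
    using A_subset_ext unfolding saturation_def by blast
qed

text \<open>If \<open>P = (P \<inter> A)[x]\<close>, the generators and the extended chain for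
  \<open>P \<inter> A\<close> suffice. Otherwise both grow by one: \<open>h\<close> of minimal
  degree joins the generators and \<open>P\<close> tops the chain. Pseudo-division of an element of
  \<open>P\<close> by \<open>h\<close> leaves a remainder in \<open>P\<close> of degree below that
  of \<open>h\<close>, hence in \<open>(P \<inter> A)[x]\<close>.\<close>

lemma locally_regular_ext:
  assumes "locally_regular A"
  shows "locally_regular (ext A)"
  unfolding locally_regular_def
proof (intro allI impI)
  fix P assume P: "primeideal P B.ring_A"
  let ?Q = "P \<inter> A"
  have Q: "primeideal ?Q ring_A" by (rule contraction_primeideal[OF P])
  obtain n C f where C: "prime_chain ring_A C n" "C n = ?Q" and f: "f ` {..<n} \<subseteq> ?Q"
    and gen: "?Q \<subseteq> saturation A ?Q (Idl\<^bsub>ring_A\<^esub> (f ` {..<n}))"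
    using assms Q unfolding locally_regular_def by meson
  have chain: "prime_chain B.ring_A (\<lambda>i. ext (C i)) n"
    unfolding prime_chain_def
  proof (intro conjI allI impI)
    fix i assume "i \<le> n"
    then show "primeideal (ext (C i)) B.ring_A"
      using C by (auto simp: prime_chain_def intro: ext_primeideal)
  next
    fix i assume "i < n"
    then have "primeideal (C i) ring_A" "primeideal (C (Suc i)) ring_A" "C i \<subset> C (Suc i)"
      using C by (auto simp: prime_chain_def)
    then show "ext (C i) \<subset> ext (C (Suc i))"
      by (intro ext_strict_mono primeidealD(1))
  qed
  have PB: "P \<subseteq> ext A" by (rule B.primeidealD(5)[OF P])
  show "\<exists>n C f. prime_chain B.ring_A C n \<and> C n = P \<and> f ` {..<n} \<subseteq> P \<and>
       P \<subseteq> saturation (ext A) P (Idl\<^bsub>B.ring_A\<^esub> (f ` {..<n::nat}))"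
  proof (cases "P \<subseteq> ext ?Q")
    case True
    then have eq: "ext ?Q = P" using ext_contraction_subset[OF P] by (rule subset_antisym[rotated])
    have fA: "f ` {..<n} \<subseteq> A" and fP: "f ` {..<n} \<subseteq> P" using f by auto
    have fB: "f ` {..<n} \<subseteq> ext A" using fA A_subset_ext by (rule subset_trans)
    have "ext ?Q \<subseteq> saturation (ext A) P (Idl\<^bsub>B.ring_A\<^esub> (f ` {..<n}))"
      by (rule ext_contraction_subset_saturation[OF P B.genideal_ideal[OF fB] fA
            B.genideal_self[OF fB] gen])
    with eq have "P \<subseteq> saturation (ext A) P (Idl\<^bsub>B.ring_A\<^esub> (f ` {..<n}))" by simp
    moreover have "ext (C n) = P" using C(2) eq by simp
    ultimately show ?thesis using chain fP by blast
  next
    case False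
    then obtain h where h: "h \<in> polys A" "poly h x \<in> P" "h \<notin> polys ?Q" "degree h > 0"
      "lead_coeff h \<in> A - P"
      and min: "\<And>g. g \<in> polys A \<Longrightarrow> poly g x \<in> P \<Longrightarrow> degree g < degree h \<Longrightarrow> g \<in> polys ?Q"
      using obtain_minimal_degree[OF P] by metis
    define f' where "f' = f(n := poly h x)"
    define C' where "C' = (\<lambda>i. if i \<le> n then ext (C i) else P)"
    define J where "J = Idl\<^bsub>B.ring_A\<^esub> (f' ` {..<Suc n})"
    have f'n: "f' ` {..<Suc n} = insert (poly h x) (f ` {..<n})"
      by (auto simp: f'_def lessThan_Suc)
    have f'P: "f' ` {..<Suc n} \<subseteq> P" using f h f'n by auto
    then have f'B: "f' ` {..<Suc n} \<subseteq> ext A" using PB by auto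
    have J: "ideal J B.ring_A" unfolding J_def by (rule B.genideal_ideal[OF f'B])
    have f'J: "f' ` {..<Suc n} \<subseteq> J" unfolding J_def by (rule B.genideal_self[OF f'B])
    let ?T = "saturation (ext A) P J"
    have T: "ideal ?T B.ring_A" by (rule B.saturation_ideal[OF P J])
    have extT: "ext ?Q \<subseteq> ?T"
      using f gen f'J f'n by (intro ext_contraction_subset_saturation[OF P J]) auto
    have hT: "poly h x \<in> ?T"
      using f'J f'n B.subset_saturation[OF P B.idealD(1)[OF J]] by auto
    have "P \<subseteq> ?T"
    proof
      fix g assume g: "g \<in> P"
      then obtain g' where g': "g' \<in> polys A" "g = poly g' x" using PB by (auto elim: mem_extE)
      obtain k u r where kur: "u \<in> polys A" "r \<in> polys A"
        "smult (lead_coeff h ^ k) g' = h * u + r" "degree r < degree h"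
        using pseudo_division[OF h(1,4) g'(1)] by blast
      have eq: "lead_coeff h ^ k * g = poly h x * poly u x + poly r x"
        using arg_cong[OF kur(3), of "\<lambda>p. poly p x"] g' by simp
      have cB: "lead_coeff h ^ k \<in> ext A - P"
        using h(5) A_subset_ext by (intro B.primeideal_power_notin[OF P]) auto
      have uB: "poly u x \<in> ext A" using kur by (auto simp: ext_def)
      have "poly r x = lead_coeff h ^ k * g - poly h x * poly u x" using eq by simp
      also have "\<dots> \<in> P"
        using B.primeidealD(1)[OF P] g cB uB h(2)
        by (intro B.ideal_minus[of P] B.idealD(4)[of P] B.idealD(5)[of P]) auto
      finally have "poly r x \<in> P" .
      then have "poly r x \<in> ?T"
        using min[OF kur(2) _ kur(4)] extT by (auto simp: ext_def)
      then have "lead_coeff h ^ k * g \<in> ?T"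
        unfolding eq using hT uB by (intro B.idealD(3)[OF T] B.idealD(5)[OF T])
      then show "g \<in> ?T"
        using B.saturation_saturated[OF P cB] g PB by auto
    qed
    moreover have "prime_chain B.ring_A C' (Suc n)"
    proof -
      have "ext (C n) \<subset> P"
        using False ext_contraction_subset[OF P] C by auto
      then show ?thesis
        using chain P unfolding prime_chain_def C'_def by (auto simp: less_Suc_eq)
    qed
    ultimately show ?thesis
      using f'P unfolding J_def
      by (intro exI[of _ "Suc n"] exI[of _ C'] exI[of _ f']) (auto simp: C'_def)
  qed
qed

section \<open>Contraction of prime chains and finiteness of height\<close>

text \<open>Three nested primes cannot lie over one prime \<open>q\<close>. With \<open>f\<close>
  and \<open>h\<close> of minimal degree in \<open>P1\<close> and \<open>P2\<close> outside
  \<open>q[x]\<close>, division of \<open>f\<close> by \<open>h\<close> puts \<open>h * u\<close> in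
  \<open>P1\<close> up to a remainder in \<open>q[x]\<close>. As \<open>h\<close> is not in
  \<open>P1\<close>, the quotient \<open>u\<close> is, and its degree is below that of
  \<open>f\<close>; so \<open>u\<close>, and with it a multiple of \<open>f\<close> by a power of
  the leading coefficient of \<open>h\<close>, has coefficients in \<open>q\<close>, contradicting
  the choice of \<open>f\<close>.\<close>

lemma contraction_strict:
  assumes P0: "primeideal P0 B.ring_A" and P1: "primeideal P1 B.ring_A"
    and P2: "primeideal P2 B.ring_A" and sub: "P0 \<subset> P1" "P1 \<subset> P2"
  shows "P0 \<inter> A \<noteq> P2 \<inter> A"
proof
  assume eq: "P0 \<inter> A = P2 \<inter> A"
  define q where "q = P2 \<inter> A"
  \<comment> \<open>Contractions increase along the chain, so the middle one is squeezed between two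
    equal ones.\<close>
  have q: "P0 \<inter> A = q" "P1 \<inter> A = q" "P2 \<inter> A = q" using eq sub by (auto simp: q_def)
  have qp: "primeideal q ring_A" unfolding q_def by (rule contraction_primeideal[OF P2])
  have ext0: "ext q \<subseteq> P0" using ext_contraction_subset[OF P0] q by simp
  have "\<not> P1 \<subseteq> ext (P1 \<inter> A)" "\<not> P2 \<subseteq> ext (P2 \<inter> A)" using ext0 sub q by auto
  then obtain f h where f: "f \<in> polys A" "poly f x \<in> P1" "f \<notin> polys q" "degree f > 0"
      "lead_coeff f \<in> A - P1"
    and fmin: "\<And>g. g \<in> polys A \<Longrightarrow> poly g x \<in> P1 \<Longrightarrow> degree g < degree f \<Longrightarrow> g \<in> polys q"
    and h: "h \<in> polys A" "poly h x \<in> P2" "h \<notin> polys q" "degree h > 0"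
      "lead_coeff h \<in> A - P2"
    and hmin: "\<And>g. g \<in> polys A \<Longrightarrow> poly g x \<in> P2 \<Longrightarrow> degree g < degree h \<Longrightarrow> g \<in> polys q"
    using obtain_minimal_degree[OF P1] obtain_minimal_degree[OF P2] q by metis
  have division: "\<exists>k u r. u \<in> polys A \<and> r \<in> polys q \<and> smult (lead_coeff h ^ k) g = h * u + r \<and>
      degree r < degree h" if g: "g \<in> polys A" "poly g x \<in> P2" for g
  proof -
    obtain k u r where kur: "u \<in> polys A" "r \<in> polys A"
      "smult (lead_coeff h ^ k) g = h * u + r" "degree r < degree h"
      using pseudo_division[OF h(1,4) g(1)] by blast
    have "poly r x = lead_coeff h ^ k * poly g x - poly h x * poly u x"
      using arg_cong[OF kur(3), of "\<lambda>p. poly p x"] by simp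
    also have "\<dots> \<in> P2"
      using B.primeidealD(1)[OF P2] g h kur A_subset_ext
      by (intro B.ideal_minus[of P2] B.idealD(4)[of P2] B.idealD(5)[of P2])
         (auto intro!: B.power_mem simp: ext_def)
    finally show ?thesis using kur hmin by blast
  qed
  have lcP1: "lead_coeff h ^ k \<in> ext A - P1" for k
    using h(5) sub A_subset_ext by (intro B.primeideal_power_notin[OF P1]) auto
  have extP1: "poly r x \<in> P1" if "r \<in> polys q" for r
    using that ext0 sub by (auto simp: ext_def)
  \<comment> \<open>Otherwise division by \<open>h\<close> would place every element of
    \<open>P2\<close> in \<open>P1\<close>, after cancelling a power of the leading coefficient of
    \<open>h\<close>.\<close>
  have hP1: "poly h x \<notin> P1"
  proof
    assume hP1: "poly h x \<in> P1"
    have "P2 \<subseteq> P1"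
    proof
      fix g assume "g \<in> P2"
      then obtain g' where g': "g' \<in> polys A" "g = poly g' x" "poly g' x \<in> P2"
        using B.primeidealD(5)[OF P2] by (auto elim: mem_extE)
      obtain k u r where kur: "u \<in> polys A" "r \<in> polys q"
        "smult (lead_coeff h ^ k) g' = h * u + r"
        using division[OF g'(1,3)] by blast
      have "lead_coeff h ^ k * g = poly h x * poly u x + poly r x"
        using arg_cong[OF kur(3), of "\<lambda>p. poly p x"] g' by simp
      also have "\<dots> \<in> P1"
        using B.primeidealD(1)[OF P1] hP1 kur extP1
        by (intro B.idealD(3)[of P1] B.idealD(5)[of P1]) (auto simp: ext_def)
      finally show "g \<in> P1"
        using B.primeidealD(3)[OF P1, of "lead_coeff h ^ k" g] lcP1 g' by (auto simp: ext_def)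
    qed
    then show False using sub by auto
  qed
  obtain k u r where kur: "u \<in> polys A" "r \<in> polys q"
    "smult (lead_coeff h ^ k) f = h * u + r" "degree r < degree h"
    using division[of f] f sub by blast
  have hf: "degree h \<le> degree f"
    using hmin[of f] f sub by force
  have "poly h x * poly u x = lead_coeff h ^ k * poly f x - poly r x"
    using arg_cong[OF kur(3), of "\<lambda>p. poly p x"] by simp
  also have "\<dots> \<in> P1"
    using B.primeidealD(1)[OF P1] f(2) lcP1 extP1[OF kur(2)]
    by (intro B.ideal_minus[of P1] B.idealD(4)[of P1]) auto
  finally have "poly u x \<in> P1"
    using B.primeidealD(3)[OF P1, of "poly h x" "poly u x"] hP1 h kur by (auto simp: ext_def)
  moreover have "degree u < degree f"
  proof (cases "u = 0")
    case False
    then have "degree h + degree u = degree (h * u)"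
      using h by (subst degree_mult_eq) auto
    also have "h * u = smult (lead_coeff h ^ k) f - r" using kur(3) by simp
    also have "degree \<dots> \<le> degree f"
      using kur(4) hf by (intro degree_diff_le) auto
    finally show ?thesis using h(4) by simp
  qed (use f in auto)
  ultimately have "u \<in> polys q" using fmin kur by blast
  then have "smult (lead_coeff h ^ k) f \<in> polys q"
    using kur h unfolding kur(3) by (intro polys_ideal_add polys_ideal_mult primeidealD(1)[OF qp])
  then have "lead_coeff h ^ k * lead_coeff f \<in> q" by (auto simp: polys_def)
  moreover have "lead_coeff h ^ k \<in> A - q"
    using h q by (intro primeideal_power_notin[OF qp]) auto
  ultimately show False
    using primeidealD(3)[OF qp, of "lead_coeff h ^ k" "lead_coeff f"] f q by auto
qed

text \<open>Every second member of a chain contracts to a strictly larger prime than the one two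
  places before it. The bound serves only to show that heights are finite.\<close>

lemma prime_chain_length_ext:
  assumes bound: "\<And>Q n. prime_chain ring_A Q n \<Longrightarrow> n \<le> m"
    and Q: "prime_chain B.ring_A Q n"
  shows "n \<le> 2 * m + 1"
proof (rule ccontr)
  assume n: "\<not> n \<le> 2 * m + 1"
  have "prime_chain ring_A (\<lambda>i. Q (2 * i) \<inter> A) (Suc m)"
    unfolding prime_chain_def
  proof (intro conjI allI impI)
    fix i assume "i \<le> Suc m"
    then show "primeideal (Q (2 * i) \<inter> A) ring_A"
      using Q n unfolding prime_chain_def by (intro contraction_primeideal) auto
  next
    fix i assume "i < Suc m"
    then have "Q (2 * i) \<subset> Q (Suc (2 * i))" "Q (Suc (2 * i)) \<subset> Q (Suc (Suc (2 * i)))"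
      "primeideal (Q (2 * i)) B.ring_A" "primeideal (Q (Suc (2 * i))) B.ring_A"
      "primeideal (Q (Suc (Suc (2 * i)))) B.ring_A"
      using Q n unfolding prime_chain_def by auto
    then show "Q (2 * i) \<inter> A \<subset> Q (2 * Suc i) \<inter> A"
      using contraction_strict[of "Q (2 * i)" "Q (Suc (2 * i))" "Q (Suc (Suc (2 * i)))"] by auto
  qed
  then show False using bound by fastforce
qed

end

section \<open>Polynomial rings over a field\<close>

definition mpolys :: "nat \<Rightarrow> ((nat \<Rightarrow>\<^sub>0 nat) \<Rightarrow>\<^sub>0 'k::field) set" where
  "mpolys N = {f. \<forall>m \<in> Poly_Mapping.keys f. Poly_Mapping.keys m \<subseteq> {..<N}}"

lemma mpoly_ring_eq: "mpoly_ring N = subring_of_type (mpolys N)"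
  by (simp add: mpoly_ring_def mpolys_def)

lemma mpolys_subring: "unital_subring (mpolys N :: ((nat \<Rightarrow>\<^sub>0 nat) \<Rightarrow>\<^sub>0 'k::field) set)"
proof
  fix f g :: "(nat \<Rightarrow>\<^sub>0 nat) \<Rightarrow>\<^sub>0 'k"
  assume fg: "f \<in> mpolys N" "g \<in> mpolys N"
  then show "f + g \<in> mpolys N"
    using Poly_Mapping.keys_add[of f g] by (auto simp: mpolys_def)
  show "f * g \<in> mpolys N"
  proof -
    have "Poly_Mapping.keys (u + v) \<subseteq> {..<N}"
      if "u \<in> Poly_Mapping.keys f" "v \<in> Poly_Mapping.keys g" for u v
      using that fg Poly_Mapping.keys_add[of u v] unfolding mpolys_def by blast
    then show ?thesis
      using keys_mult[of f g] unfolding mpolys_def by blast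
  qed
qed (auto simp: mpolys_def in_keys_iff)

interpretation mpolys: unital_subring "mpolys N" for N
  by (rule mpolys_subring)

lemma single_mem_mpolys: "Poly_Mapping.keys u \<subseteq> {..<N} \<Longrightarrow> Poly_Mapping.single u a \<in> mpolys N"
  by (auto simp: mpolys_def)

lemma poly_mapping_eq_sum_single:
  assumes "finite U" "Poly_Mapping.keys f \<subseteq> U"
  shows "f = (\<Sum>u\<in>U. Poly_Mapping.single u (Poly_Mapping.lookup f u))"
proof (rule poly_mapping_eqI)
  fix v
  have "(\<Sum>u\<in>U. Poly_Mapping.lookup f u when u = v) = (\<Sum>u\<in>U. if u = v then Poly_Mapping.lookup f u else 0)"
    by (intro sum.cong) auto
  also have "\<dots> = Poly_Mapping.lookup f v"
    using assms by (auto simp: in_keys_iff)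
  finally show "Poly_Mapping.lookup f v =
      Poly_Mapping.lookup (\<Sum>u\<in>U. Poly_Mapping.single u (Poly_Mapping.lookup f u)) v"
    by (simp add: lookup_sum lookup_single)
qed

lemma lookup_mult_single:
  fixes f :: "'a::comm_monoid_add \<Rightarrow>\<^sub>0 'b::comm_semiring_1"
  shows "Poly_Mapping.lookup (f * Poly_Mapping.single v 1) w =
    (\<Sum>u\<in>Poly_Mapping.keys f. Poly_Mapping.lookup f u when u + v = w)"
proof -
  have "f * Poly_Mapping.single v 1 =
      (\<Sum>u\<in>Poly_Mapping.keys f. Poly_Mapping.single (u + v) (Poly_Mapping.lookup f u))"
    by (subst (1) poly_mapping_eq_sum_single[of "Poly_Mapping.keys f" f])
       (simp_all add: sum_distrib_right mult_single)
  then show ?thesis by (simp add: lookup_sum lookup_single)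
qed

definition mvar :: "nat \<Rightarrow> (nat \<Rightarrow>\<^sub>0 nat) \<Rightarrow>\<^sub>0 'k::field" where
  "mvar i = Poly_Mapping.single (Poly_Mapping.single i 1) 1"

lemma mvar_power: "mvar i ^ n = Poly_Mapping.single (Poly_Mapping.single i n) 1"
  by (induction n) (simp_all add: mvar_def mult_single flip: single_add)

text \<open>Coefficients in \<open>mpolys N\<close> do not involve the variable with index
  \<open>N\<close>, so different powers of \<open>mvar N\<close> contribute to disjoint sets of
  exponent vectors.\<close>

lemma mpolys_Suc_extension:
  "polynomial_extension (mpolys N) (mvar N :: (nat \<Rightarrow>\<^sub>0 nat) \<Rightarrow>\<^sub>0 'k::field)"
proof
  fix p :: "((nat \<Rightarrow>\<^sub>0 nat) \<Rightarrow>\<^sub>0 'k) poly"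
  assume p: "p \<in> polys (mpolys N)" and 0: "poly p (mvar N) = 0"
  have "Poly_Mapping.lookup (coeff p i) m = 0" if "i \<le> degree p" for i m
  proof (cases "Poly_Mapping.keys m \<subseteq> {..<N}")
    case False
    then have "m \<notin> Poly_Mapping.keys (coeff p i)"
      using p unfolding polys_def mpolys_def by blast
    then show ?thesis by (simp add: in_keys_iff)
  next
    case True
    \<comment> \<open>At this exponent vector the value of \<open>p\<close> shows exactly the
      coefficient of \<open>coeff p i\<close> at \<open>m\<close>.\<close>
    let ?w = "m + Poly_Mapping.single N i"
    have "Poly_Mapping.lookup (coeff p j * mvar N ^ j) ?w =
        (Poly_Mapping.lookup (coeff p i) m when j = i)" for j
    proof -
      have "u + Poly_Mapping.single N j = ?w \<longleftrightarrow> j = i \<and> u = m"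
        if "u \<in> Poly_Mapping.keys (coeff p j)" for u
      proof
        assume eq: "u + Poly_Mapping.single N j = ?w"
        have "Poly_Mapping.keys u \<subseteq> {..<N}" using that p by (auto simp: polys_def mpolys_def)
        then have "Poly_Mapping.lookup u N = 0" "Poly_Mapping.lookup m N = 0"
          using True by (auto simp: in_keys_iff)
        then have "j = i"
          using arg_cong[OF eq, of "\<lambda>z. Poly_Mapping.lookup z N"] by (simp add: lookup_add)
        then show "j = i \<and> u = m" using eq by simp
      qed auto
      then have "Poly_Mapping.lookup (coeff p j * mvar N ^ j) ?w =
          (\<Sum>u\<in>Poly_Mapping.keys (coeff p j). if u = m then Poly_Mapping.lookup (coeff p j) m when j = i else 0)"
        unfolding mvar_power lookup_mult_single by (intro sum.cong) auto
      also have "\<dots> = (Poly_Mapping.lookup (coeff p i) m when j = i)"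
        by (cases "j = i") (auto simp: in_keys_iff)
      finally show ?thesis .
    qed
    then have "Poly_Mapping.lookup (poly p (mvar N)) ?w =
        (\<Sum>j\<le>degree p. if j = i then Poly_Mapping.lookup (coeff p i) m else 0)"
      unfolding poly_altdef lookup_sum by (intro sum.cong) auto
    with 0 that show ?thesis by simp
  qed
  then have "lead_coeff p = 0" by (intro poly_mapping_eqI) simp
  then show "p = 0" by simp
qed

lemma mpolys_Suc:
  "mpolys (Suc N) =
    polynomial_extension.ext (mvar N :: (nat \<Rightarrow>\<^sub>0 nat) \<Rightarrow>\<^sub>0 'k::field) (mpolys N)"
proof -
  interpret polynomial_extension "mpolys N" "mvar N :: (nat \<Rightarrow>\<^sub>0 nat) \<Rightarrow>\<^sub>0 'k"
    by (rule mpolys_Suc_extension)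
  show ?thesis
  proof
    show "ext (mpolys N) \<subseteq> mpolys (Suc N)"
    proof
      fix g assume "g \<in> ext (mpolys N)"
      then obtain p where p: "p \<in> polys (mpolys N)" "g = poly p (mvar N)" by (rule mem_extE)
      have "coeff p i \<in> mpolys (Suc N)" for i
        using p by (fastforce simp: polys_def mpolys_def)
      moreover have "(mvar N :: (nat \<Rightarrow>\<^sub>0 nat) \<Rightarrow>\<^sub>0 'k) \<in> mpolys (Suc N)"
        unfolding mvar_def by (rule single_mem_mpolys) simp
      ultimately show "g \<in> mpolys (Suc N)"
        unfolding p poly_altdef by (intro mpolys.sum_mem mpolys.mult_mem mpolys.power_mem) auto
    qed
  next
    show "mpolys (Suc N) \<subseteq> ext (mpolys N)"
    proof
      fix f :: "(nat \<Rightarrow>\<^sub>0 nat) \<Rightarrow>\<^sub>0 'k"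
      assume f: "f \<in> mpolys (Suc N)"
      have "Poly_Mapping.single u a \<in> ext (mpolys N)" if "u \<in> Poly_Mapping.keys f" for u a
      proof -
        define v where "v = Poly_Mapping.update N 0 u"
        have u: "u = v + Poly_Mapping.single N (Poly_Mapping.lookup u N)"
          by (rule poly_mapping_eqI) (auto simp: v_def lookup_add lookup_update lookup_single when_def)
        have "Poly_Mapping.keys u \<subseteq> {..<Suc N}" using f that by (auto simp: mpolys_def)
        then have "Poly_Mapping.keys v \<subseteq> {..<N}"
          by (auto simp: v_def in_keys_iff lookup_update subset_iff less_Suc_eq split: if_splits)
        then have "Poly_Mapping.single v a \<in> ext (mpolys N)"
          by (intro subsetD[OF A_subset_ext] single_mem_mpolys)
        moreover have "Poly_Mapping.single u a =
            Poly_Mapping.single v a * mvar N ^ Poly_Mapping.lookup u N"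
          unfolding mvar_power mult_single by (subst u) simp
        ultimately show ?thesis using power_x_mem by auto
      qed
      then have "(\<Sum>u\<in>Poly_Mapping.keys f. Poly_Mapping.single u (Poly_Mapping.lookup f u)) \<in> ext (mpolys N)"
        by (intro B.sum_mem)
      then show "f \<in> ext (mpolys N)"
        using poly_mapping_eq_sum_single[of "Poly_Mapping.keys f" f] by simp
    qed
  qed
qed

lemma constant_notin_primeideal:
  fixes a :: "'k::field"
  assumes P: "primeideal P (subring_of_type (mpolys N))" and a: "a \<noteq> 0"
  shows "Poly_Mapping.single 0 a \<notin> P"
proof
  assume "Poly_Mapping.single 0 a \<in> P"
  moreover have "Poly_Mapping.single 0 (inverse a) \<in> mpolys N"
    by (rule single_mem_mpolys) simp
  ultimately have "Poly_Mapping.single 0 (inverse a) * Poly_Mapping.single 0 a \<in> P"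
    using mpolys.idealD(4) mpolys.primeidealD(1)[OF P] by blast
  then show False using a mpolys.primeidealD(2)[OF P] by (simp add: mult_single)
qed

text \<open>Without variables the ring consists of constants, so it is the field itself.\<close>

lemma primeideal_mpolys_0:
  fixes P :: "((nat \<Rightarrow>\<^sub>0 nat) \<Rightarrow>\<^sub>0 'k::field) set"
  assumes P: "primeideal P (subring_of_type (mpolys 0))"
  shows "P = {0}"
proof -
  have "f = 0" if "f \<in> P" for f
  proof -
    have "Poly_Mapping.keys f \<subseteq> {0}"
      using that mpolys.primeidealD(5)[OF P] by (auto simp: mpolys_def)
    then have "f = Poly_Mapping.single 0 (Poly_Mapping.lookup f 0)"
      using poly_mapping_eq_sum_single[of "{0}" f] by simp
    then show ?thesis
      using that constant_notin_primeideal[OF P] by (metis single_zero)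
  qed
  then show ?thesis using mpolys.primeidealD(4)[OF P] by auto
qed

lemma locally_regular_mpolys:
  "locally_regular (mpolys N :: ((nat \<Rightarrow>\<^sub>0 nat) \<Rightarrow>\<^sub>0 'k::field) set)"
proof (induction N)
  case 0
  show ?case
    unfolding locally_regular_def
  proof (intro allI impI)
    fix P :: "((nat \<Rightarrow>\<^sub>0 nat) \<Rightarrow>\<^sub>0 'k) set"
    assume P: "primeideal P (subring_of_type (mpolys 0))"
    let ?I = "Idl\<^bsub>subring_of_type (mpolys 0)\<^esub> {} :: ((nat \<Rightarrow>\<^sub>0 nat) \<Rightarrow>\<^sub>0 'k) set"
    have "ideal ?I (subring_of_type (mpolys 0))" by (rule mpolys.genideal_ideal) simp
    then have "P \<subseteq> saturation (mpolys 0) P ?I"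
      using mpolys.saturation_ideal[OF P] mpolys.idealD(2) primeideal_mpolys_0[OF P] by blast
    then show "\<exists>n Q f. prime_chain (subring_of_type (mpolys 0)) Q n \<and> Q n = P \<and> f ` {..<n} \<subseteq> P \<and>
       P \<subseteq> saturation (mpolys 0) P (Idl\<^bsub>subring_of_type (mpolys 0)\<^esub> (f ` {..<n::nat}))"
      using P by (intro exI[of _ 0] exI[of _ "\<lambda>_. P"]) (auto simp: prime_chain_def)
  qed
next
  case (Suc N)
  then show ?case
    unfolding mpolys_Suc by (rule polynomial_extension.locally_regular_ext[OF mpolys_Suc_extension])
qed

lemma prime_chain_length_mpolys:
  "\<exists>m. \<forall>Q n. prime_chain (subring_of_type (mpolys N :: ((nat \<Rightarrow>\<^sub>0 nat) \<Rightarrow>\<^sub>0 'k::field) set)) Q n \<longrightarrow> n \<le> m"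
proof (induction N)
  case 0
  have "n = 0"
    if "prime_chain (subring_of_type (mpolys 0 :: ((nat \<Rightarrow>\<^sub>0 nat) \<Rightarrow>\<^sub>0 'k::field) set)) Q n" for Q n
  proof (rule ccontr)
    assume "n \<noteq> 0"
    with that have "Q 0 = {0}" "Q 1 = {0}" "Q 0 \<subset> Q 1"
      by (auto simp: prime_chain_def intro!: primeideal_mpolys_0)
    then show False by simp
  qed
  then show ?case by blast
next
  case (Suc N)
  then show ?case
    unfolding mpolys_Suc
    using polynomial_extension.prime_chain_length_ext[OF mpolys_Suc_extension] by metis
qed

text \<open>The uniform bound on chain lengths makes the height finite, so \<open>the_enat\<close>
  returns its true value.\<close>

lemma prime_chain_le_height:
  fixes P :: "((nat \<Rightarrow>\<^sub>0 nat) \<Rightarrow>\<^sub>0 'k::field) set"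
  assumes Q: "prime_chain (subring_of_type (mpolys N)) Q n" "Q n = P"
  shows "n \<le> the_enat (height (subring_of_type (mpolys N)) P)"
proof -
  let ?R = "subring_of_type (mpolys N) :: ((nat \<Rightarrow>\<^sub>0 nat) \<Rightarrow>\<^sub>0 'k) ring"
  obtain m where m: "\<And>Q n. prime_chain ?R Q n \<Longrightarrow> n \<le> m"
    using prime_chain_length_mpolys by blast
  have height: "height ?R P = Sup {enat n | n. \<exists>Q. prime_chain ?R Q n \<and> Q n = P}"
    unfolding height_def prime_chain_def by (simp add: conj_assoc)
  have "enat n \<le> height ?R P"
    unfolding height using Q by (intro Sup_upper) blast
  moreover have "height ?R P \<le> enat m"
    unfolding height using m by (intro Sup_least) auto
  ultimately show ?thesis by (cases "height ?R P") auto
qed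

section \<open>Coordinates with respect to the Frobenius map\<close>

lemma CHAR_poly_mapping:
  "CHAR(('a::comm_monoid_add) \<Rightarrow>\<^sub>0 ('b::comm_semiring_1)) = CHAR('b)"
proof (rule CHAR_eqI)
  have *: "of_nat n = (0 :: 'a \<Rightarrow>\<^sub>0 'b) \<longleftrightarrow> of_nat n = (0 :: 'b)" for n
    by (simp flip: single_of_nat)
       (metis lookup_single_eq lookup_zero single_zero)
  show "of_nat CHAR('b) = (0 :: 'a \<Rightarrow>\<^sub>0 'b)" by (simp add: *)
  show "CHAR('b) dvd n" if "of_nat n = (0 :: 'a \<Rightarrow>\<^sub>0 'b)" for n
    using that unfolding * by (simp add: of_nat_eq_0_iff_char_dvd)
qed

text \<open>A basis of \<open>K\<close> over its subfield of \<open>q\<close>-th powers, given by its coordinate functions: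
  \<open>c b x\<close> is the \<open>q\<close>-th root of the coefficient of \<open>x\<close> at \<open>b\<close>, and vanishes if \<open>b\<close> is not in the
  basis.\<close>

locale frobenius_basis =
  fixes q :: nat and c :: "'k::field \<Rightarrow> 'k \<Rightarrow> 'k"
  assumes q_pos: "q > 0"
    and frobenius_add: "(f + g :: (nat \<Rightarrow>\<^sub>0 nat) \<Rightarrow>\<^sub>0 'k) ^ q = f ^ q + g ^ q"
    and c_add: "c b (x + y) = c b x + c b y"
    and c_scale: "c b (a ^ q * x) = a * c b x"
    and c_finite: "finite {b. c b x \<noteq> 0}"
    and c_sum: "(\<Sum>b | c b x \<noteq> 0. c b x ^ q * b) = x"

text \<open>Let the field act on itself by \<open>a ^ q * x\<close>. This is a vector space by
  additivity of the Frobenius map, and its coordinate functions already return the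
  \<open>q\<close>-th roots of the coefficients.\<close>

lemma ex_frobenius_basis:
  assumes "CHAR('k::field) > 0"
  obtains c :: "'k::field \<Rightarrow> 'k \<Rightarrow> 'k" where "frobenius_basis (CHAR('k::field) ^ e) c"
proof -
  define q where "q = CHAR('k) ^ e"
  have p: "prime CHAR('k)" using assms by (rule prime_CHAR_semidom)
  have frob: "(x + y) ^ q = x ^ q + y ^ q" for x y :: 'k
    unfolding q_def by (rule freshmans_dream'[OF p]) simp
  interpret vector_space "\<lambda>a x :: 'k. a ^ q * x"
    by unfold_locales (simp_all add: frob algebra_simps power_mult_distrib)
  define B where "B = extend_basis {}"
  have B: "independent B" "span B = UNIV"
    unfolding B_def by (simp_all add: independent_extend_basis span_extend_basis independent_empty)
  have "frobenius_basis q (\<lambda>b x. representation B x b)"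
  proof
    show "q > 0" using assms by (simp add: q_def)
    show "(f + g :: (nat \<Rightarrow>\<^sub>0 nat) \<Rightarrow>\<^sub>0 'k) ^ q = f ^ q + g ^ q" for f g
      by (rule freshmans_dream') (use p in \<open>simp_all add: CHAR_poly_mapping q_def\<close>)
  qed (use B in \<open>simp_all add: representation_add representation_scale finite_representation
      sum_nonzero_representation_eq\<close>)
  then show ?thesis using that by (simp add: q_def)
qed

context frobenius_basis
begin

abbreviation mdiv :: "(nat \<Rightarrow>\<^sub>0 nat) \<Rightarrow> (nat \<Rightarrow>\<^sub>0 nat)" where
  "mdiv u \<equiv> Poly_Mapping.map (\<lambda>n. n div q) u"

abbreviation mmod :: "(nat \<Rightarrow>\<^sub>0 nat) \<Rightarrow> (nat \<Rightarrow>\<^sub>0 nat)" where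
  "mmod u \<equiv> Poly_Mapping.map (\<lambda>n. n mod q) u"

abbreviation mscale :: "nat \<Rightarrow> (nat \<Rightarrow>\<^sub>0 nat) \<Rightarrow> (nat \<Rightarrow>\<^sub>0 nat)" where
  "mscale m u \<equiv> Poly_Mapping.map ((*) m) u"

lemma lookup_map_0: "f 0 = 0 \<Longrightarrow> Poly_Mapping.lookup (Poly_Mapping.map f u) i = f (Poly_Mapping.lookup u i)"
  by (simp add: Poly_Mapping.map.rep_eq when_def)

lemma keys_map_subset: "f 0 = 0 \<Longrightarrow> Poly_Mapping.keys (Poly_Mapping.map f u) \<subseteq> Poly_Mapping.keys u"
  by (auto simp: in_keys_iff lookup_map_0)

lemma frobenius_sum: "(\<Sum>i\<in>Z. f i :: (nat \<Rightarrow>\<^sub>0 nat) \<Rightarrow>\<^sub>0 'k) ^ q = (\<Sum>i\<in>Z. f i ^ q)"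
  using q_pos by (induction Z rule: infinite_finite_induct) (simp_all add: frobenius_add)

lemma c_0 [simp]: "c b 0 = 0"
  using c_scale[of b 0 0] q_pos by simp

text \<open>\<open>f\<close> is the sum of \<open>(coord b w f)\<^sup>q * single w b\<close>, where \<open>b\<close> ranges over the basis and \<open>w\<close> over
  the exponent vectors with entries below \<open>q\<close>.\<close>

definition coord :: "'k \<Rightarrow> (nat \<Rightarrow>\<^sub>0 nat) \<Rightarrow> ((nat \<Rightarrow>\<^sub>0 nat) \<Rightarrow>\<^sub>0 'k) \<Rightarrow> ((nat \<Rightarrow>\<^sub>0 nat) \<Rightarrow>\<^sub>0 'k)" where
  "coord b w f =
    (\<Sum>u\<in>Poly_Mapping.keys f. Poly_Mapping.single (mdiv u) (c b (Poly_Mapping.lookup f u)) when mmod u = w)"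

lemma coord_eq_sum:
  "finite U \<Longrightarrow> Poly_Mapping.keys f \<subseteq> U \<Longrightarrow> coord b w f =
    (\<Sum>u\<in>U. Poly_Mapping.single (mdiv u) (c b (Poly_Mapping.lookup f u)) when mmod u = w)"
  unfolding coord_def by (intro sum.mono_neutral_left) (auto simp: in_keys_iff)

lemma coord_add: "coord b w (f + g) = coord b w f + coord b w g"
proof -
  let ?U = "Poly_Mapping.keys f \<union> Poly_Mapping.keys g"
  have "Poly_Mapping.keys (f + g) \<subseteq> ?U" by (rule Poly_Mapping.keys_add)
  then show ?thesis
    by (simp add: coord_eq_sum[of ?U] lookup_add c_add single_add when_add_distrib sum.distrib)
qed

lemma coord_0 [simp]: "coord b w 0 = 0"
  by (simp add: coord_def)

lemma coord_sum: "coord b w (\<Sum>i\<in>Z. f i) = (\<Sum>i\<in>Z. coord b w (f i))"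
  by (induction Z rule: infinite_finite_induct) (simp_all add: coord_add)

lemma coord_single:
  "coord b w (Poly_Mapping.single u a) = (Poly_Mapping.single (mdiv u) (c b a) when mmod u = w)"
  by (subst coord_eq_sum[of "{u}"]) auto

lemma single_power: "Poly_Mapping.single u a ^ n = Poly_Mapping.single (mscale n u) (a ^ n)"
proof (induction n)
  case 0
  have "mscale 0 u = 0" by (rule poly_mapping_eqI) (simp add: lookup_map_0)
  then show ?case by (simp only: power_0 single_one)
next
  case (Suc n)
  have "u + mscale n u = mscale (Suc n) u"
    by (rule poly_mapping_eqI) (simp add: lookup_map_0 lookup_add)
  then show ?case by (simp only: power_Suc Suc.IH mult_single)
qed

text \<open>Adding \<open>q\<close> times \<open>v\<close> to an exponent vector adds
  \<open>v\<close> to the quotients by \<open>q\<close> and leaves the remainders alone.\<close>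

lemma coord_single_power_mult_single:
  "coord b w (Poly_Mapping.single v a ^ q * Poly_Mapping.single u d) =
    Poly_Mapping.single v a * coord b w (Poly_Mapping.single u d)"
proof -
  have "mdiv (mscale q v + u) = v + mdiv u" "mmod (mscale q v + u) = mmod u"
    by (rule poly_mapping_eqI, use q_pos in \<open>simp add: lookup_map_0 lookup_add\<close>)+
  then show ?thesis
    by (simp add: single_power mult_single coord_single c_scale mult_when)
qed

lemma coord_power_mult: "coord b w (g ^ q * f) = g * coord b w f"
proof -
  let ?s = "\<lambda>f u. Poly_Mapping.single u (Poly_Mapping.lookup f u)"
  let ?F = "Poly_Mapping.keys f" and ?G = "Poly_Mapping.keys g"
  have f: "f = (\<Sum>u\<in>?F. ?s f u)" and g: "g = (\<Sum>v\<in>?G. ?s g v)"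
    by (simp_all flip: poly_mapping_eq_sum_single)
  have "g ^ q * f = (\<Sum>v\<in>?G. ?s g v ^ q) * (\<Sum>u\<in>?F. ?s f u)"
    using f g frobenius_sum[of "?s g" ?G] by simp
  also have "\<dots> = (\<Sum>v\<in>?G. \<Sum>u\<in>?F. ?s g v ^ q * ?s f u)"
    by (rule sum_product)
  finally have "coord b w (g ^ q * f) = (\<Sum>v\<in>?G. \<Sum>u\<in>?F. ?s g v * coord b w (?s f u))"
    by (simp only: coord_sum coord_single_power_mult_single)
  also have "\<dots> = (\<Sum>v\<in>?G. ?s g v) * coord b w (\<Sum>u\<in>?F. ?s f u)"
    by (simp add: sum_product coord_sum)
  also have "\<dots> = g * coord b w f" using f g by simp
  finally show ?thesis .
qed

text \<open>The index set \<open>T\<close> may be larger than this monomial requires, so that a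
  single \<open>T\<close> serves all monomials of a polynomial and the two sums can be
  swapped.\<close>

lemma sum_coord_single:
  assumes "finite T" "\<And>b. c b a \<noteq> 0 \<Longrightarrow> (b, mmod u) \<in> T"
  shows "(\<Sum>(b, w)\<in>T. coord b w (Poly_Mapping.single u a) ^ q * Poly_Mapping.single w b) =
    Poly_Mapping.single u a"
proof -
  let ?B = "{b. c b a \<noteq> 0}"
  have u: "mscale q (mdiv u) + mmod u = u"
    by (rule poly_mapping_eqI) (simp add: lookup_map_0 lookup_add)
  have "(\<Sum>(b, w)\<in>T. coord b w (Poly_Mapping.single u a) ^ q * Poly_Mapping.single w b) =
      (\<Sum>(b, w)\<in>T. Poly_Mapping.single u (c b a ^ q * b) when mmod u = w)"
    using u q_pos by (intro sum.cong) (auto simp: coord_single single_power mult_single when_def)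
  also have "\<dots> = (\<Sum>(b, w)\<in>(\<lambda>b. (b, mmod u)) ` ?B. Poly_Mapping.single u (c b a ^ q * b) when mmod u = w)"
  proof (intro sum.mono_neutral_right ballI, goal_cases)
    case (3 x)
    then have "c (fst x) a = 0 \<or> mmod u \<noteq> snd x" by (cases x) auto
    then show ?case using q_pos by (cases x) (auto simp: power_0_left)
  qed (use assms in auto)
  also have "\<dots> = (\<Sum>b\<in>?B. Poly_Mapping.single u (c b a ^ q * b))"
    by (subst sum.reindex) (auto simp: inj_on_def)
  also have "\<dots> = Poly_Mapping.single u (\<Sum>b\<in>?B. c b a ^ q * b)"
    by (rule poly_mapping_eqI) (simp add: lookup_sum lookup_single when_def)
  finally show ?thesis by (simp add: c_sum)
qed

lemma sum_coord:
  obtains T where "finite T" "snd ` T \<subseteq> mmod ` Poly_Mapping.keys f"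
    "f = (\<Sum>(b, w)\<in>T. coord b w f ^ q * Poly_Mapping.single w b)"
proof -
  let ?K = "Poly_Mapping.keys f"
  let ?s = "\<lambda>u. Poly_Mapping.single u (Poly_Mapping.lookup f u)"
  define T where "T = (\<Union>u\<in>?K. {b. c b (Poly_Mapping.lookup f u) \<noteq> 0} \<times> {mmod u})"
  have T: "finite T" by (auto simp: T_def c_finite)
  have f: "(\<Sum>u\<in>?K. ?s u) = f"
    by (simp flip: poly_mapping_eq_sum_single)
  have "f = (\<Sum>u\<in>?K. \<Sum>(b, w)\<in>T. coord b w (?s u) ^ q * Poly_Mapping.single w b)"
    by (subst f[symmetric], intro sum.cong refl sum_coord_single[symmetric] T) (auto simp: T_def)
  also have "\<dots> = (\<Sum>(b, w)\<in>T. (\<Sum>u\<in>?K. coord b w (?s u)) ^ q * Poly_Mapping.single w b)"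
    by (subst sum.swap) (auto simp: frobenius_sum sum_distrib_right intro!: sum.cong)
  also have "\<dots> = (\<Sum>(b, w)\<in>T. coord b w f ^ q * Poly_Mapping.single w b)"
    by (simp add: f flip: coord_sum)
  finally have "f = (\<Sum>(b, w)\<in>T. coord b w f ^ q * Poly_Mapping.single w b)" .
  moreover have "snd ` T \<subseteq> mmod ` ?K" by (auto simp: T_def)
  ultimately show ?thesis using that T by blast
qed

lemma coord_mem_mpolys:
  assumes "f \<in> mpolys N"
  shows "coord b w f \<in> mpolys N"
  unfolding coord_def
proof (rule mpolys.sum_mem)
  fix u assume "u \<in> Poly_Mapping.keys f"
  then have "Poly_Mapping.keys u \<subseteq> {..<N}" using assms unfolding mpolys_def by blast
  then have "Poly_Mapping.keys (mdiv u) \<subseteq> {..<N}"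
    using keys_map_subset[of "\<lambda>n. n div q" u] by auto
  then show "(Poly_Mapping.single (mdiv u) (c b (Poly_Mapping.lookup f u)) when mmod u = w) \<in> mpolys N"
    by (simp add: when_def single_mem_mpolys)
qed

text \<open>One direction shows that the polynomials all of whose multiples have coordinates in
  \<open>L\<close> form an ideal containing the \<open>q\<close>-th powers; the other rebuilds
  \<open>f\<close> from its coordinates.\<close>

lemma mem_frobenius_power_iff:
  assumes L: "ideal L (subring_of_type (mpolys N))" and f: "f \<in> mpolys N"
  shows "f \<in> frobenius_power (subring_of_type (mpolys N)) q L \<longleftrightarrow> (\<forall>b w. coord b w f \<in> L)"
proof
  let ?R = "subring_of_type (mpolys N) :: ((nat \<Rightarrow>\<^sub>0 nat) \<Rightarrow>\<^sub>0 'k) ring"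
  note LN = mpolys.idealD(1)[OF L]
  have power: "(\<lambda>g. g [^]\<^bsub>?R\<^esub> q) ` L \<subseteq> mpolys N" using LN by auto
  show "\<forall>b w. coord b w f \<in> L" if "f \<in> frobenius_power ?R q L"
  proof -
    \<comment> \<open>Coordinates are linear only over \<open>q\<close>-th powers, so closure under
      arbitrary multiples is built into the set.\<close>
    let ?J = "{g \<in> mpolys N. \<forall>a\<in>mpolys N. \<forall>b w. coord b w (a * g) \<in> L}"
    have "ideal ?J ?R"
      unfolding mpolys.ideal_iff
    proof (intro conjI ballI)
      fix r g :: "(nat \<Rightarrow>\<^sub>0 nat) \<Rightarrow>\<^sub>0 'k"
      assume r: "r \<in> mpolys N" and g: "g \<in> ?J"
      have "coord b w (a * (r * g)) \<in> L" if "a \<in> mpolys N" for a b w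
      proof -
        have "a * r \<in> mpolys N" using that r by (rule mpolys.mult_mem)
        then have "coord b w (a * r * g) \<in> L" using g by blast
        then show ?thesis by (simp only: mult.assoc)
      qed
      then show "r * g \<in> ?J" using r g mpolys.mult_mem by blast
    qed (use mpolys.idealD[OF L] in \<open>auto simp: distrib_left coord_add\<close>)
    moreover have "(\<lambda>g. g [^]\<^bsub>?R\<^esub> q) ` L \<subseteq> ?J"
    proof
      fix h assume "h \<in> (\<lambda>g. g [^]\<^bsub>?R\<^esub> q) ` L"
      then obtain g where g: "g \<in> L" "h = g ^ q" by auto
      have "coord b w (a * h) \<in> L" if "a \<in> mpolys N" for a b w
      proof -
        have "coord b w (a * h) = g * coord b w a"
          unfolding g(2) by (subst mult.commute) (rule coord_power_mult)
        then show ?thesis using mpolys.idealD(5)[OF L coord_mem_mpolys[OF that] g(1)] by simp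
      qed
      then show "h \<in> ?J" using g LN by auto
    qed
    ultimately have "frobenius_power ?R q L \<subseteq> ?J"
      unfolding frobenius_power_def by (rule mpolys.genideal_minimal)
    then have "f \<in> ?J" using that by (rule subsetD)
    then have "coord b w (1 * f) \<in> L" for b w using mpolys.one_mem by blast
    then show ?thesis by simp
  qed
  show "f \<in> frobenius_power ?R q L" if co: "\<forall>b w. coord b w f \<in> L"
  proof -
    obtain T where T: "finite T" "snd ` T \<subseteq> mmod ` Poly_Mapping.keys f"
      "f = (\<Sum>(b, w)\<in>T. coord b w f ^ q * Poly_Mapping.single w b)"
      by (rule sum_coord)
    have I: "ideal (frobenius_power ?R q L) ?R"
      unfolding frobenius_power_def by (rule mpolys.genideal_ideal[OF power])
    have "(\<Sum>(b, w)\<in>T. coord b w f ^ q * Poly_Mapping.single w b) \<in> frobenius_power ?R q L"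
    proof (rule mpolys.ideal_sum[OF I], clarify)
      fix b w assume "(b, w) \<in> T"
      then obtain u where u: "u \<in> Poly_Mapping.keys f" "w = mmod u" using T by force
      then have "Poly_Mapping.keys u \<subseteq> {..<N}" using f unfolding mpolys_def by blast
      then have "Poly_Mapping.keys w \<subseteq> {..<N}"
        using keys_map_subset[of "\<lambda>n. n mod q" u] u by auto
      moreover have "coord b w f ^ q \<in> frobenius_power ?R q L"
        unfolding frobenius_power_def using co by (intro subsetD[OF mpolys.genideal_self[OF power]]) auto
      ultimately show "coord b w f ^ q * Poly_Mapping.single w b \<in> frobenius_power ?R q L"
        by (intro mpolys.idealD(5)[OF I] single_mem_mpolys)
    qed
    then show ?thesis using T(3) by simp
  qed
qed

text \<open>The ideal generated by all coordinates of elements of \<open>J\<close> is the least one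
  whose Frobenius power contains \<open>J\<close>; hence the \<open>LEAST\<close> in
  \<open>frobenius_root\<close> is attained.\<close>

lemma frobenius_root_least:
  fixes J L :: "((nat \<Rightarrow>\<^sub>0 nat) \<Rightarrow>\<^sub>0 'k) set"
  assumes J: "J \<subseteq> mpolys N" and L: "ideal L (subring_of_type (mpolys N))"
    and "J \<subseteq> frobenius_power (subring_of_type (mpolys N)) q L"
  shows "frobenius_root (subring_of_type (mpolys N)) q J \<subseteq> L"
proof -
  let ?R = "subring_of_type (mpolys N) :: ((nat \<Rightarrow>\<^sub>0 nat) \<Rightarrow>\<^sub>0 'k) ring"
  let ?G = "{coord b w f | b w f. f \<in> J}"
  have G: "?G \<subseteq> mpolys N" using J coord_mem_mpolys by auto
  have le: "J \<subseteq> frobenius_power ?R q M \<longleftrightarrow> ?G \<subseteq> M" if "ideal M ?R" for M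
    using mem_frobenius_power_iff[OF that] J by blast
  have "frobenius_root ?R q J = Idl\<^bsub>?R\<^esub> ?G"
    unfolding frobenius_root_def
  proof (rule Least_equality)
    note G_ideal = mpolys.genideal_ideal[OF G]
    show "ideal (Idl\<^bsub>?R\<^esub> ?G) ?R \<and> J \<subseteq> frobenius_power ?R q (Idl\<^bsub>?R\<^esub> ?G)"
      unfolding le[OF G_ideal] by (intro conjI G_ideal mpolys.genideal_self[OF G])
    fix M assume M: "ideal M ?R \<and> J \<subseteq> frobenius_power ?R q M"
    then have "?G \<subseteq> M" using le[of M] by (simp only:)
    then show "Idl\<^bsub>?R\<^esub> ?G \<subseteq> M" using M by (intro mpolys.genideal_minimal) (simp only:)
  qed
  also have "\<dots> \<subseteq> L"
    using assms(3) unfolding le[OF L] by (rule mpolys.genideal_minimal[OF L])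
  finally show ?thesis .
qed

text \<open>On coordinates, multiplication by \<open>s ^ q\<close> is multiplication by
  \<open>s\<close>.\<close>

lemma mem_frobenius_power_cancel:
  fixes L :: "((nat \<Rightarrow>\<^sub>0 nat) \<Rightarrow>\<^sub>0 'k) set"
  assumes L: "ideal L (subring_of_type (mpolys N))" and "s \<in> mpolys N" "f \<in> mpolys N"
    and "s ^ q * f \<in> frobenius_power (subring_of_type (mpolys N)) q L"
    and "\<And>g. g \<in> mpolys N \<Longrightarrow> s * g \<in> L \<Longrightarrow> g \<in> L"
  shows "f \<in> frobenius_power (subring_of_type (mpolys N)) q L"
proof -
  have "s ^ q * f \<in> mpolys N" using assms by auto
  then have "s * coord b w f \<in> L" for b w
    using mem_frobenius_power_iff[OF L] assms(4) by (simp add: coord_power_mult)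
  from assms(5)[OF coord_mem_mpolys[OF assms(3)] this] show ?thesis
    by (simp add: mem_frobenius_power_iff[OF L assms(3)])
qed

text \<open>Exponents below \<open>q\<close> have quotient zero, so the coordinates of
  \<open>f\<close> are constants. One of them is nonzero, hence a unit, and cannot lie in
  \<open>P\<close>.\<close>

lemma notin_frobenius_power_of_small_degree:
  fixes P :: "((nat \<Rightarrow>\<^sub>0 nat) \<Rightarrow>\<^sub>0 'k) set"
  assumes P: "primeideal P (subring_of_type (mpolys N))" and f: "f \<in> mpolys N" "f \<noteq> 0"
    and small: "\<And>u i. u \<in> Poly_Mapping.keys f \<Longrightarrow> Poly_Mapping.lookup u i < q"
  shows "f \<notin> frobenius_power (subring_of_type (mpolys N)) q P"
proof
  assume "f \<in> frobenius_power (subring_of_type (mpolys N)) q P"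
  then have co: "coord b w f \<in> P" for b w
    by (simp add: mem_frobenius_power_iff[OF mpolys.primeidealD(1)[OF P] f(1)])
  obtain u where u: "u \<in> Poly_Mapping.keys f" using f(2) by fastforce
  let ?a = "Poly_Mapping.lookup f u"
  have "{b. c b ?a \<noteq> 0} \<noteq> {}"
  proof
    assume "{b. c b ?a \<noteq> 0} = {}"
    then have "?a = 0" using c_sum[of ?a] by simp
    then show False using u by (simp add: in_keys_iff)
  qed
  then obtain b where b: "c b ?a \<noteq> 0" by blast
  have div: "mdiv v = 0" "mmod v = v" if "v \<in> Poly_Mapping.keys f" for v
    using small[OF that] by (auto intro!: poly_mapping_eqI simp: lookup_map_0)
  have "coord b u f = (\<Sum>v\<in>Poly_Mapping.keys f. if v = u then Poly_Mapping.single 0 (c b ?a) else 0)"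
    unfolding coord_def by (intro sum.cong) (auto simp: div when_def)
  also have "\<dots> = Poly_Mapping.single 0 (c b ?a)" using u by simp
  finally show False using constant_notin_primeideal[OF P b] co[of b u] by simp
qed

end

section \<open>Symbolic powers and Frobenius powers\<close>

lemma symbolic_power_ideal:
  fixes A :: "'a::idom set"
  assumes "unital_subring A" "primeideal P (subring_of_type A)"
  shows "ideal (symbolic_power (subring_of_type A) P l) (subring_of_type A)"
proof -
  interpret unital_subring A by fact
  show ?thesis
  proof (cases "l \<le> 0")
    case True
    then show ?thesis by (auto simp: symbolic_power_def ideal_iff)
  next
    case False
    then show ?thesis
      using assms by (simp add: symbolic_power_eq_saturation saturation_ideal ideal_power_ideal primeidealD)
  qed
qed

lemma symbolic_power_1_subset:
  fixes A :: "'a::idom set"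
  assumes A: "unital_subring A" and P: "primeideal P (subring_of_type A)"
  shows "symbolic_power (subring_of_type A) P 1 \<subseteq> P"
proof -
  interpret unital_subring A by fact
  have "ideal_power ring_A P 1 \<subseteq> P"
    unfolding One_nat_def ideal_power_Suc
    by (intro ideal_prod_subset primeidealD(1)[OF P])
      (auto intro: idealD(4)[OF primeidealD(1)[OF P]])
  then show ?thesis
    using primeidealD(3)[OF P]
    by (auto simp: symbolic_power_eq_saturation[OF A P] saturation_def)
qed

context frobenius_basis
begin

text \<open>A monomial of degree \<open>k\<close> in \<open>n\<close> generators of \<open>P\<close> is a multiple of the \<open>q\<close>-th power of a
  monomial of degree at least \<open>j\<close>.\<close>

lemma symbolic_power_subset_frobenius_power:
  fixes P :: "((nat \<Rightarrow>\<^sub>0 nat) \<Rightarrow>\<^sub>0 'k) set" and N :: nat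
  defines "R \<equiv> subring_of_type (mpolys N)"
  assumes P: "primeideal P R" and f: "f ` {..<n} \<subseteq> P"
    and gen: "P \<subseteq> saturation (mpolys N) P (Idl\<^bsub>R\<^esub> (f ` {..<n}))"
    and k: "k > 0" and j: "j > 0" and kj: "q * (j + n - 1) < k + n"
  shows "symbolic_power R P (int k) \<subseteq> frobenius_power R q (symbolic_power R P (int j))"
proof -
  let ?A = "mpolys N :: ((nat \<Rightarrow>\<^sub>0 nat) \<Rightarrow>\<^sub>0 'k) set"
  note [simp] = R_def
  note P = P[unfolded R_def] and gen = gen[unfolded R_def]
  note PI = mpolys.primeidealD(1)[OF P]
  define L where "L = symbolic_power R P (int j)"
  have L: "ideal L R" unfolding L_def R_def by (rule symbolic_power_ideal[OF mpolys_subring P])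
  have L_eq: "L = saturation ?A P (ideal_power R P j)"
    unfolding L_def R_def using j by (subst symbolic_power_eq_saturation[OF mpolys_subring P]) auto
  let ?F = "frobenius_power R q L"
  have fA: "f i \<in> ?A" if "i < n" for i
    using f that mpolys.primeidealD(5)[OF P] by auto
  have "(\<lambda>g. g [^]\<^bsub>R\<^esub> q) ` L \<subseteq> ?A" using mpolys.idealD(1)[OF L[unfolded R_def]] by auto
  from mpolys.genideal_ideal[OF this] mpolys.genideal_self[OF this]
  have F: "ideal ?F R" and LF: "g \<in> L \<Longrightarrow> g ^ q \<in> ?F" for g
    unfolding frobenius_power_def by auto
  have F': "ideal ?F (subring_of_type ?A)" using F unfolding R_def .
  let ?X = "\<lambda>k. {\<Prod>i<n. f i ^ a i | a. (\<Sum>i<n. a i) = k}"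
  \<comment> \<open>This replaces the \<open>k\<close>-th power of the ideal generated by the
    \<open>f i\<close>; the explicit monomial generators give access to exponents for the pigeonhole
    argument.\<close>
  define M where "M k = Idl\<^bsub>R\<^esub> (?X k)" for k
  have XA: "?X k \<subseteq> ?A" for k
    using fA by (auto intro!: mpolys.prod_mem mpolys.power_mem)
  have M: "ideal (M k) R" for k unfolding M_def R_def by (rule mpolys.genideal_ideal[OF XA])
  have XM: "?X k \<subseteq> M k" for k unfolding M_def R_def by (rule mpolys.genideal_self[OF XA])
  have M0: "M 0 = ?A"
  proof
    show "M 0 \<subseteq> ?A" using mpolys.idealD(1) M by auto
    have "(\<Prod>i<n. f i ^ 0) \<in> M 0" by (rule subsetD[OF XM], rule CollectI, rule exI[of _ "\<lambda>_. 0"]) simp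
    then show "?A \<subseteq> M 0" using mpolys.idealD(4)[OF M[unfolded R_def], of _ 1] by auto
  qed
  have mono_mult: "u * f i \<in> M (Suc k)" if i: "i < n" and u: "u \<in> M k" for i k u
  proof -
    let ?T = "{u \<in> ?A. u * f i \<in> M (Suc k)}"
    have "?X k \<subseteq> ?T"
    proof
      fix m assume "m \<in> ?X k"
      then obtain a where a: "m = (\<Prod>i<n. f i ^ a i)" "(\<Sum>i<n. a i) = k" by blast
      let ?a = "a(i := Suc (a i))"
      have "(\<Prod>l<n. f l ^ ?a l) = f i ^ Suc (a i) * (\<Prod>l\<in>{..<n} - {i}. f l ^ a l)"
        using i by (subst prod.remove[of _ i]) auto
      also have "\<dots> = m * f i"
        unfolding a using i by (subst (2) prod.remove[of _ i]) (auto simp: mult_ac)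
      finally have "m * f i = (\<Prod>l<n. f l ^ ?a l)" by simp
      moreover have "(\<Sum>l<n. ?a l) = Suc k"
        unfolding a(2)[symmetric] using i
        by (subst (1 2) sum.remove[of _ i]) auto
      ultimately have "m * f i \<in> M (Suc k)" by (intro subsetD[OF XM]) blast
      then show "m \<in> ?T" using \<open>m \<in> ?X k\<close> XA by blast
    qed
    moreover have "ideal ?T R" unfolding R_def by (rule mpolys.ideal_colon[OF M[unfolded R_def]])
    ultimately have "M k \<subseteq> ?T" unfolding M_def R_def by (intro mpolys.genideal_minimal)
    then show ?thesis using u by blast
  qed
  have "u * v \<in> M (Suc k)" if u: "u \<in> M k" and v: "v \<in> Idl\<^bsub>R\<^esub> (f ` {..<n})" for k u v
  proof -
    let ?T = "{v \<in> ?A. v * u \<in> M (Suc k)}"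
    have "ideal ?T R" unfolding R_def by (rule mpolys.ideal_colon[OF M[unfolded R_def]])
    moreover have "f ` {..<n} \<subseteq> ?T" using mono_mult[OF _ u] fA by (auto simp: mult.commute)
    ultimately have "Idl\<^bsub>R\<^esub> (f ` {..<n}) \<subseteq> ?T" unfolding R_def by (intro mpolys.genideal_minimal)
    then show ?thesis using v by (auto simp: mult.commute)
  qed
  then have power: "ideal_power R P k \<subseteq> saturation ?A P (M k)" for k
    unfolding R_def
    using mpolys.ideal_power_saturation[where J = M, OF P M[unfolded R_def] M0 gen] by simp
  have MF: "M k \<subseteq> ?F"
    unfolding M_def R_def
  proof (rule mpolys.genideal_minimal)
    show "?X k \<subseteq> frobenius_power (subring_of_type (mpolys N)) q L"
    proof
      fix m assume "m \<in> ?X k"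
      then obtain a where a: "m = (\<Prod>i<n. f i ^ a i)" "(\<Sum>i<n. a i) = k" by blast
      \<comment> \<open>The remainders of the exponents add up to at most
        \<open>n * (q - 1)\<close>, so \<open>k + n \<le> q * (?d + n)\<close>, and
        \<open>kj\<close> forces \<open>j \<le> ?d\<close>.\<close>
      let ?d = "\<Sum>i<n. a i div q"
      have "k = (\<Sum>i<n. q * (a i div q) + a i mod q)" using a by simp
      also have "\<dots> = q * ?d + (\<Sum>i<n. a i mod q)" by (simp only: sum.distrib sum_distrib_left)
      finally have "k = q * ?d + (\<Sum>i<n. a i mod q)" .
      moreover have "(\<Sum>i<n. a i mod q) \<le> (\<Sum>i<n. q - 1)"
        using mod_less_divisor[OF q_pos] by (intro sum_mono) (metis One_nat_def Suc_pred less_Suc_eq_le q_pos)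
      ultimately have "k \<le> q * ?d + n * (q - 1)" by simp
      moreover have "n * (q - 1) + n = q * n" using q_pos by (cases q) (auto simp: algebra_simps)
      then have "q * ?d + n * (q - 1) + n = q * (?d + n)" by (simp add: algebra_simps)
      ultimately have "q * (j + n - 1) < q * (?d + n)" using kj by linarith
      then have "j + n - 1 < ?d + n" by simp
      then have "j \<le> ?d" by linarith
      let ?g = "\<Prod>i<n. f i ^ (a i div q)"
      have "?g \<in> ideal_power R P ?d"
        unfolding R_def using f by (intro mpolys.prod_powers_mem_ideal_power[OF PI]) auto
      also have "\<dots> \<subseteq> ideal_power R P j"
        unfolding R_def by (rule mpolys.ideal_power_antimono[OF PI \<open>j \<le> ?d\<close>])
      also have "\<dots> \<subseteq> L"
        unfolding L_eq R_def
        by (intro mpolys.subset_saturation[OF P] mpolys.idealD(1) mpolys.ideal_power_ideal PI)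
      finally have "?g ^ q \<in> ?F" by (rule LF)
      moreover have "(\<Prod>i<n. f i ^ (a i mod q)) \<in> ?A"
        using fA by (intro mpolys.prod_mem mpolys.power_mem) auto
      ultimately have "?g ^ q * (\<Prod>i<n. f i ^ (a i mod q)) \<in> ?F"
        using mpolys.idealD(5)[OF F'] by simp
      moreover have "?g ^ q * (\<Prod>i<n. f i ^ (a i mod q)) = m"
        unfolding a by (simp add: prod_power_distrib flip: power_mult power_add prod.distrib)
      ultimately show "m \<in> frobenius_power (subring_of_type (mpolys N)) q L" by simp
    qed
  qed (use F in simp)
  show ?thesis
    unfolding L_def[symmetric]
  proof
    fix g assume "g \<in> symbolic_power R P (int k)"
    then obtain s where s: "g \<in> ?A" "s \<in> ?A - P" "s * g \<in> ideal_power R P k"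
      unfolding R_def symbolic_power_eq_saturation[OF mpolys_subring P, of "int k", simplified, OF k]
      by (auto simp: saturation_def)
    then obtain s' where s': "s' \<in> ?A - P" "s' * (s * g) \<in> ?F"
      using power[of k] MF by (auto simp: saturation_def)
    let ?s = "s' * s"
    have sA: "?s \<in> ?A - P" by (rule mpolys.primeideal_mult_notin[OF P s'(1) s(2)])
    \<comment> \<open>The extra factor completes the multiplier to a \<open>q\<close>-th power,
      which can be cancelled because \<open>L\<close> is saturated.\<close>
    have "?s ^ q * g = ?s ^ (q - 1) * (s' * (s * g))"
      using q_pos by (cases q) (auto simp: mult_ac)
    also have "\<dots> \<in> ?F"
      using s' sA by (intro mpolys.idealD(4)[OF F', of "?s ^ (q - 1)"]) auto
    finally show "g \<in> ?F"
      unfolding R_def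
      using sA s L
      by (intro mem_frobenius_power_cancel[of L N ?s g])
        (auto simp: L_eq intro: mpolys.saturation_saturated[OF P sA])
  qed
qed

end

section \<open>Finiteness of the vanishing order\<close>

lemma GreatestI_int:
  fixes Q :: "int \<Rightarrow> bool"
  assumes "Q l" "\<And>m. Q m \<Longrightarrow> m \<le> b"
  shows "Q (GREATEST m. Q m)" "l \<le> (GREATEST m. Q m)"
proof -
  let ?S = "{m. Q m \<and> l \<le> m}"
  have "?S \<subseteq> {l..b}" using assms(2) by auto
  then have S: "finite ?S" "?S \<noteq> {}" using assms(1) by (auto intro: finite_subset)
  have "(GREATEST m. Q m) = Max ?S"
  proof (rule Greatest_equality)
    show "Q (Max ?S)" using Max_in[OF S] by simp
    show "m \<le> Max ?S" if "Q m" for m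
      using Max_ge[OF S(1), of m] Max_in[OF S] that by (cases "l \<le> m") auto
  qed
  then show "Q (GREATEST m. Q m)" "l \<le> (GREATEST m. Q m)" using Max_in[OF S] by simp_all
qed

text \<open>Membership in a symbolic power of high order would put \<open>g\<close> in a Frobenius
  power of \<open>P\<close> with \<open>q\<close> above all its exponents. The bound makes the
  \<open>GREATEST\<close> in \<open>vanishing_order\<close> meaningful.\<close>

lemma symbolic_powers_bounded:
  fixes P :: "((nat \<Rightarrow>\<^sub>0 nat) \<Rightarrow>\<^sub>0 'k::field) set" and N :: nat
  defines "R \<equiv> subring_of_type (mpolys N)"
  assumes char: "CHAR('k) > 0" and P: "primeideal P R" and g: "g \<in> mpolys N" "g \<noteq> 0"
  shows "\<exists>b. \<forall>l. g \<in> symbolic_power R P l \<longrightarrow> l \<le> b"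
proof -
  note P = P[unfolded R_def]
  obtain n f Q where f: "f ` {..<n} \<subseteq> P"
    and gen: "P \<subseteq> saturation (mpolys N) P (Idl\<^bsub>R\<^esub> (f ` {..<n::nat}))"
    using locally_regular_mpolys P unfolding locally_regular_def R_def by metis
  let ?E = "\<Union>u\<in>Poly_Mapping.keys g. Poly_Mapping.lookup u ` Poly_Mapping.keys u"
  \<comment> \<open>Since \<open>e < p^e\<close>, this choice puts all exponents of \<open>g\<close>
    below \<open>q\<close>; the inserted 0 gives \<open>Max\<close> a nonempty set when
    \<open>g\<close> is constant.\<close>
  define e where "e = Suc (Max (insert 0 ?E))"
  have "Poly_Mapping.lookup u i < CHAR('k) ^ e" if u: "u \<in> Poly_Mapping.keys g" for u i
  proof -
    have "Poly_Mapping.lookup u i \<in> insert 0 ?E"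
    proof (cases "i \<in> Poly_Mapping.keys u")
      case True
      then show ?thesis using u by blast
    qed (simp add: in_keys_iff)
    then have "Poly_Mapping.lookup u i < e" unfolding e_def by (intro le_imp_less_Suc Max_ge) auto
    also have "e < CHAR('k) ^ e"
      using prime_gt_1_nat[OF prime_CHAR_semidom[OF char]] by (intro power_gt_expt) simp
    finally show ?thesis .
  qed
  moreover define q where "q = CHAR('k) ^ e"
  ultimately have small: "Poly_Mapping.lookup u i < q" if "u \<in> Poly_Mapping.keys g" for u i
    using that by simp
  obtain c :: "'k \<Rightarrow> 'k \<Rightarrow> 'k" where "frobenius_basis q c"
    using ex_frobenius_basis[OF char, of e] unfolding q_def by blast
  then interpret frobenius_basis q c .
  \<comment> \<open>Beyond \<open>q * n\<close> the numerical condition for containment in the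
    Frobenius power is met with \<open>j = 1\<close>.\<close>
  have "l \<le> int (q * n)" if l: "g \<in> symbolic_power R P l" for l
  proof (rule ccontr)
    assume neg: "\<not> l \<le> int (q * n)"
    define k where "k = nat l"
    have "int (q * n) < l" using neg by (simp only: not_le)
    moreover from this have "l = int k"
      unfolding k_def by (intro nat_0_le[symmetric]) (use of_nat_0_le_iff[of "q * n"] in linarith)
    ultimately have k: "l = int k" "q * n < k" by (simp_all only: of_nat_less_iff)
    then have k: "l = int k" "k > 0" "q * (1 + n - 1) < k + n" by simp_all
    have "g \<in> frobenius_power R q (symbolic_power R P (int 1))"
      using l symbolic_power_subset_frobenius_power[OF P f gen[unfolded R_def] k(2) _ k(3)] k(1)
      unfolding R_def by auto
    then have "g \<in> frobenius_power R q P"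
      using mem_frobenius_power_iff[OF symbolic_power_ideal[OF mpolys_subring P] g(1)]
        mem_frobenius_power_iff[OF mpolys.primeidealD(1)[OF P] g(1)]
        symbolic_power_1_subset[OF mpolys_subring P]
      unfolding R_def by auto
    then show False
      using notin_frobenius_power_of_small_degree[OF P g small] by (simp add: R_def)
  qed
  then show ?thesis by blast
qed

lemma vanishing_order_mpolys:
  fixes P :: "((nat \<Rightarrow>\<^sub>0 nat) \<Rightarrow>\<^sub>0 'k::field) set" and N :: nat
  defines "R \<equiv> subring_of_type (mpolys N)"
  assumes "CHAR('k) > 0" "primeideal P R" "I \<subseteq> mpolys N" "g \<in> I" "g \<noteq> 0"
  shows "I \<subseteq> symbolic_power R P (vanishing_order R P I)" "vanishing_order R P I \<ge> 0"
proof -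
  obtain b where "g \<in> symbolic_power R P l \<Longrightarrow> l \<le> b" for l
    using symbolic_powers_bounded[of P N g] assms by auto
  then have b: "l \<le> b" if "I \<subseteq> symbolic_power R P l" for l
    using that assms(5) by blast
  have "I \<subseteq> symbolic_power R P 0" using assms(1,4) by (simp add: symbolic_power_def)
  from GreatestI_int[of "\<lambda>l. I \<subseteq> symbolic_power R P l", OF this b]
  show "I \<subseteq> symbolic_power R P (vanishing_order R P I)" "vanishing_order R P I \<ge> 0"
    unfolding vanishing_order_def by auto
qed

section \<open>The containment at a fixed prime and a fixed Frobenius level\<close>

lemma frobenius_root_subset_symbolic_power:
  fixes P :: "((nat \<Rightarrow>\<^sub>0 nat) \<Rightarrow>\<^sub>0 'k::field) set" and N :: nat
  defines "R \<equiv> subring_of_type (mpolys N)"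
  assumes char: "CHAR('k) > 0" and P: "primeideal P R" and I: "ideal I R" "I \<subseteq> P"
    and g: "g \<in> I" "g \<noteq> 0" and t: "t > 0" and q: "q = CHAR('k) ^ e"
  shows "frobenius_root R q (ideal_power R I (nat \<lceil>t * real q\<rceil>)) \<subseteq>
    symbolic_power R P
      (\<lfloor>t * real_of_int (vanishing_order R P I)\<rfloor> + 1 - int (the_enat (height R P)))"
    (is "frobenius_root R q ?J \<subseteq> symbolic_power R P ?j")
proof -
  let ?A = "mpolys N :: ((nat \<Rightarrow>\<^sub>0 nat) \<Rightarrow>\<^sub>0 'k) set"
  note P = P[unfolded R_def] and I = I[unfolded R_def]
  obtain c :: "'k \<Rightarrow> 'k \<Rightarrow> 'k" where "frobenius_basis q c"
    using ex_frobenius_basis[OF char, of e] unfolding q by blast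
  then interpret frobenius_basis q c .
  define m where "m = vanishing_order R P I"
  define h where "h = the_enat (height R P)"
  define r where "r = nat \<lceil>t * real q\<rceil>"
  have m: "I \<subseteq> symbolic_power R P m" "m \<ge> 0"
    unfolding m_def R_def using vanishing_order_mpolys[OF char P mpolys.idealD(1)[OF I(1)] g] by auto
  have J: "ideal ?J R" unfolding R_def by (rule mpolys.ideal_power_ideal[OF I(1)])
  have JA: "?J \<subseteq> ?A" using mpolys.idealD(1) J unfolding R_def by blast
  have L: "ideal (symbolic_power R P ?j) R"
    unfolding R_def by (rule symbolic_power_ideal[OF mpolys_subring P])
  have "?J \<subseteq> frobenius_power R q (symbolic_power R P ?j)"
  \<comment> \<open>Here the symbolic power is the whole ring, whose Frobenius power is again the
    whole ring.\<close>
  proof (cases "?j \<le> 0")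
    case True
    then have "symbolic_power R P ?j = ?A" by (simp add: symbolic_power_def R_def)
    then show ?thesis
      using JA mem_frobenius_power_iff[OF L[unfolded R_def]] coord_mem_mpolys
      unfolding R_def by blast
  next
    case False
    obtain n Q f where Q: "prime_chain R Q n" "Q n = P" and f: "f ` {..<n} \<subseteq> P"
      and gen: "P \<subseteq> saturation ?A P (Idl\<^bsub>R\<^esub> (f ` {..<n::nat}))"
      using locally_regular_mpolys P unfolding locally_regular_def R_def by metis
    have nh: "n \<le> h" using prime_chain_le_height Q unfolding h_def R_def by blast
    \<comment> \<open>Without local generators \<open>P\<close> would vanish locally, yet it
      contains \<open>g\<close>. Positivity of \<open>n\<close> forces \<open>m > 0\<close> below
      and turns \<open>q * (j + n - 1) \<le> k\<close> into the strict bound by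
      \<open>k + n\<close>.\<close>
    have "n > 0"
    proof (rule ccontr)
      assume "\<not> n > 0"
      moreover have "Idl\<^bsub>R\<^esub> {} \<subseteq> {0}"
        unfolding R_def by (rule mpolys.genideal_minimal) (auto simp: mpolys.ideal_iff)
      ultimately have "P \<subseteq> saturation ?A P {0}"
        using gen mpolys.saturation_mono[of _ "{0}" N P] by auto
      then obtain s where "s \<in> ?A - P" "s * g = 0" using g I(2) by (auto simp: saturation_def)
      then show False using g(2) mpolys.primeidealD(4)[OF P] by auto
    qed
    have tm: "\<lfloor>t * m\<rfloor> = ?j + int h - 1" unfolding h_def m_def by simp
    then have "\<lfloor>t * m\<rfloor> \<ge> 1" using False nh \<open>n > 0\<close> by linarith
    then have mpos: "m > 0" using m(2) t by (cases "m = 0") auto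
    have "r > 0" using t q_pos by (simp add: r_def)
    define k where "k = nat m * r"
    have k: "k > 0" using mpos \<open>r > 0\<close> by (simp add: k_def)
    have "nat ?j > 0" using False by simp
    \<comment> \<open>Rounding \<open>t * q\<close> up to \<open>r\<close> and \<open>t * m\<close>
      down goes in the right direction:
      \<open>q * \<lfloor>t * m\<rfloor> \<le> r * m = k\<close>.\<close>
    have "real q * \<lfloor>t * m\<rfloor> \<le> real q * (t * m)"
      by (intro mult_left_mono) auto
    also have "\<dots> = (t * real q) * m" by simp
    also have "\<dots> \<le> real r * m"
      unfolding r_def using mpos by (intro mult_right_mono real_nat_ceiling_ge) auto
    also have "\<dots> = real k" using mpos by (simp add: k_def)
    finally have "real_of_int (int q * \<lfloor>t * m\<rfloor>) \<le> real_of_int (int k)" by simp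
    then have "int q * \<lfloor>t * m\<rfloor> \<le> int k" by (simp only: of_int_le_iff)
    \<comment> \<open>The number \<open>n\<close> of local generators is at most the height, and
      \<open>?j\<close> was chosen so that \<open>?j + h - 1\<close> is exactly the floor.\<close>
    moreover have "int (nat ?j + n - 1) \<le> \<lfloor>t * m\<rfloor>"
      using tm nh False by linarith
    ultimately have "int q * int (nat ?j + n - 1) \<le> int k"
      by (meson mult_left_mono of_nat_0_le_iff order_trans)
    then have "q * (nat ?j + n - 1) \<le> k" by (simp flip: of_nat_mult)
    then have kj: "q * (nat ?j + n - 1) < k + n" using \<open>n > 0\<close> by linarith
    have "?J \<subseteq> saturation ?A P (ideal_power R P (nat m * r))"
      unfolding R_def r_def[symmetric]
    proof (rule mpolys.ideal_power_saturation[OF P, where J = "\<lambda>k. ideal_power R P (nat m * k)" and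
          T = "ideal_power R P (nat m)", unfolded R_def])
      show "I \<subseteq> saturation ?A P (ideal_power (subring_of_type ?A) P (nat m))"
        using m(1) symbolic_power_eq_saturation[OF mpolys_subring P mpos] unfolding R_def by simp
    next
      fix k u v
      assume "u \<in> ideal_power (subring_of_type ?A) P (nat m * k)"
        "v \<in> ideal_power (subring_of_type ?A) P (nat m)"
      from mpolys.mult_mem_ideal_power_add[OF mpolys.primeidealD(1)[OF P] this]
      show "u * v \<in> ideal_power (subring_of_type ?A) P (nat m * Suc k)" by (simp add: add.commute)
    qed (simp_all add: mpolys.ideal_power_ideal mpolys.primeidealD(1)[OF P])
    also have "\<dots> = symbolic_power R P (int k)"
      unfolding R_def k_def[symmetric]
      using k symbolic_power_eq_saturation[OF mpolys_subring P, of "int k"] by simp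
    also have "\<dots> \<subseteq> frobenius_power R q (symbolic_power R P (int (nat ?j)))"
      unfolding R_def
      using symbolic_power_subset_frobenius_power[OF P f gen[unfolded R_def] k \<open>nat ?j > 0\<close> kj]
      by (simp add: R_def)
    finally show ?thesis using False by simp
  qed
  with frobenius_root_least[OF JA L[unfolded R_def]] show ?thesis by (simp add: R_def)
qed

theorem proposition3p2:
  fixes N :: nat
    and I :: "((nat \<Rightarrow>\<^sub>0 nat) \<Rightarrow>\<^sub>0 'k::field) set"
    and S :: "((nat \<Rightarrow>\<^sub>0 nat) \<Rightarrow>\<^sub>0 'k) ring"
    and t :: real
  assumes "S = mpoly_ring N"
    and "CHAR('k) > 0"
    and "ideal I S"
    and "I \<noteq> {\<zero>\<^bsub>S\<^esub>}"
    and "t > 0"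
  shows "test_ideal S CHAR('k) t I \<subseteq>
    carrier S \<inter>
    (\<Inter>P\<in>{P. primeideal P S \<and> I \<subseteq> P}.
      symbolic_power S P
        (\<lfloor>t * real_of_int (vanishing_order S P I)\<rfloor> + 1 - int (the_enat (height S P))))"
proof -
  note S = assms(1)[unfolded mpoly_ring_eq]
  note I = assms(3)[unfolded S]
  obtain g where g: "g \<in> I" "g \<noteq> 0"
    using assms(4) mpolys.idealD(2)[OF I] by (auto simp: S)
  \<comment> \<open>When \<open>I\<close> is the unit ideal no prime contains it and the
    intersection over primes is the whole type, so containment in the ring is shown
    separately.\<close>
  have "frobenius_root S (CHAR('k) ^ e) (ideal_power S I r) \<subseteq> carrier S" for e r
  proof -
    obtain c :: "'k \<Rightarrow> 'k \<Rightarrow> 'k" where "frobenius_basis (CHAR('k) ^ e) c"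
      using ex_frobenius_basis[OF assms(2), of e] by blast
    then interpret frobenius_basis "CHAR('k) ^ e" c .
    have J: "ideal_power S I r \<subseteq> mpolys N"
      unfolding S by (intro mpolys.idealD(1) mpolys.ideal_power_ideal I)
    have A: "ideal (mpolys N :: ((nat \<Rightarrow>\<^sub>0 nat) \<Rightarrow>\<^sub>0 'k) set) (subring_of_type (mpolys N))"
      by (auto simp: mpolys.ideal_iff)
    show ?thesis
      unfolding S
      using frobenius_root_least[OF J A] J mem_frobenius_power_iff[OF A] coord_mem_mpolys
      by (auto simp: S)
  qed
  moreover have "frobenius_root S (CHAR('k) ^ e) (ideal_power S I (nat \<lceil>t * real (CHAR('k) ^ e)\<rceil>)) \<subseteq>
      symbolic_power S P
        (\<lfloor>t * real_of_int (vanishing_order S P I)\<rfloor> + 1 - int (the_enat (height S P)))"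
    if "primeideal P S" "I \<subseteq> P" for e P
    using frobenius_root_subset_symbolic_power[OF assms(2) _ I _ g assms(5) refl, of P e] that
    unfolding S by simp
  ultimately show ?thesis unfolding test_ideal_def by blast
qed

end
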